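(* Let $\mathbb{E}$ be a finitely complete category which is protomodular and $\mathrm{Equ}$-saturating. Then every internal equivalence relation $R$ on an object $X$ of $\mathbb{E}$ has a centralizer, i.e. there exists a largest internal equivalence relation $\Sigma$ on $X$ such that $[R,\Sigma]=0$.
   Context: All categories are finitely complete. An internal equivalence relation $R$ on $X$ is a subobject $(d_0^R,d_1^R):R\rightarrowtail X\times X$ that is reflexive (via $s_0^R:X\to R$), symmetric and transitive; inclusion of equivalence relations on $X$ means inclusion as subobjects of $X\times X$. A morphism of equivalence relations $f:S\to R$ ($S$ on $X$, $R$ on $Y$) is a map $f:X\to Y$ together with a (unique) $\bar f:S\to R$ with $d_i^R\bar f=f d_i^S$, $i=0,1$. It is fibrant when the square $d_0^R\bar f=f d_0^S$ is a pullback. For a monomorphism $u:U\rightarrowtail X$ and an equivalence relation $T$ on $X$, $u^{-1}T$ is the inverse image of $T$ on $U$; $u$ is saturated with respect to $T$ when the induced morphism $u^{-1}T\to T$ is fibrant. $\mathrm{Equ}$-saturating: $\mathbb{E}$ is $\mathrm{Equ}$-saturating when, for any monomorphism $u:U\rightarrowtail X$ and any internal equivalence relation $S$ on $U$, among the equivalence relations $T$ on $X$ such that $u$ is saturated with respect to $T$ and $u^{-1}T\subset S$, there is a largest one, denoted $\forall_uS$. Protomodular: for the fibration of points (split epimorphisms $(f,s)$ with $fs=1$, sent to their codomain), every base-change functor (pullback along a map of $\mathbb{E}$) $\mathrm{Pt}_Y\mathbb{E}\to\mathrm{Pt}_{Y'}\mathbb{E}$ reflects isomorphisms. Every protomodular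 category is a Mal'tsev category (every internal reflexive relation is an equivalence relation). Centralization: in a Mal'tsev category, two equivalence relations $R,S$ on $X$ satisfy $[R,S]=0$ (they are connected, or centralize each other) when there is a (necessarily unique) double equivalence relation on them, i.e. an object $W$ carrying an equivalence relation $(p_0^R,p_1^R):W\rightrightarrows R$ on $R$ and an equivalence relation $(p_0^S,p_1^S):W\rightrightarrows S$ on $S$, such that $d_0^R,d_1^R:R\to X$ (with $p_0^S,p_1^S:W\to S$) and $s_0^R:X\to R$ (with the reflexivity map $S\to W$) underlie morphisms of equivalence relations between $W$ (on $R$) and $S$ (on $X$), and such that the morphism $d_0^R:W\to S$ of equivalence relations is fibrant. *)

theory Defs
  imports Main
begin

section \<open>Categories and finite limits\<close>

text \<open>\<open>Comp C g f\<close> is "g after f".\<close>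

record ('o, 'm) cat =
  Obj :: "'o set"
  Arr :: "'m set"
  Dom :: "'m \<Rightarrow> 'o"
  Cod :: "'m \<Rightarrow> 'o"
  Ide :: "'o \<Rightarrow> 'm"
  Comp :: "'m \<Rightarrow> 'm \<Rightarrow> 'm"  (infixl "\<cdot>\<index>" 70)

definition hom :: "('o, 'm) cat \<Rightarrow> 'o \<Rightarrow> 'o \<Rightarrow> 'm set" where
  "hom C A B = {f \<in> Arr C. Dom C f = A \<and> Cod C f = B}"

definition category :: "('o, 'm) cat \<Rightarrow> bool" where
  "category C \<longleftrightarrow>
     (\<forall>f\<in>Arr C. Dom C f \<in> Obj C \<and> Cod C f \<in> Obj C) \<and>
     (\<forall>A\<in>Obj C. Ide C A \<in> hom C A A) \<and>
     (\<forall>f\<in>Arr C. \<forall>g\<in>Arr C. Cod C f = Dom C g \<longrightarrow> g \<cdot>\<^bsub>C\<^esub> f \<in> hom C (Dom C f) (Cod C g)) \<and>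
     (\<forall>f\<in>Arr C. f \<cdot>\<^bsub>C\<^esub> Ide C (Dom C f) = f \<and> Ide C (Cod C f) \<cdot>\<^bsub>C\<^esub> f = f) \<and>
     (\<forall>f\<in>Arr C. \<forall>g\<in>Arr C. \<forall>h\<in>Arr C. Cod C f = Dom C g \<and> Cod C g = Dom C h \<longrightarrow>
        h \<cdot>\<^bsub>C\<^esub> (g \<cdot>\<^bsub>C\<^esub> f) = (h \<cdot>\<^bsub>C\<^esub> g) \<cdot>\<^bsub>C\<^esub> f)"

definition monic :: "('o, 'm) cat \<Rightarrow> 'm \<Rightarrow> bool" where
  "monic C m \<longleftrightarrow> m \<in> Arr C \<and>
     (\<forall>f\<in>Arr C. \<forall>g\<in>Arr C. Dom C f = Dom C g \<and> Cod C f = Dom C m \<and> Cod C g = Dom C m \<and>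
        m \<cdot>\<^bsub>C\<^esub> f = m \<cdot>\<^bsub>C\<^esub> g \<longrightarrow> f = g)"

definition iso :: "('o, 'm) cat \<Rightarrow> 'm \<Rightarrow> bool" where
  "iso C f \<longleftrightarrow> f \<in> Arr C \<and>
     (\<exists>g\<in>hom C (Cod C f) (Dom C f).
        g \<cdot>\<^bsub>C\<^esub> f = Ide C (Dom C f) \<and> f \<cdot>\<^bsub>C\<^esub> g = Ide C (Cod C f))"

definition is_functor ::
    "('i, 'j) cat \<Rightarrow> ('o, 'm) cat \<Rightarrow> ('i \<Rightarrow> 'o) \<Rightarrow> ('j \<Rightarrow> 'm) \<Rightarrow> bool" where
  "is_functor J C F0 F1 \<longleftrightarrow>
     (\<forall>i\<in>Obj J. F0 i \<in> Obj C \<and> F1 (Ide J i) = Ide C (F0 i)) \<and>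
     (\<forall>a\<in>Arr J. F1 a \<in> hom C (F0 (Dom J a)) (F0 (Cod J a))) \<and>
     (\<forall>a\<in>Arr J. \<forall>b\<in>Arr J. Cod J a = Dom J b \<longrightarrow> F1 (b \<cdot>\<^bsub>J\<^esub> a) = F1 b \<cdot>\<^bsub>C\<^esub> F1 a)"

definition is_cone ::
    "('i, 'j) cat \<Rightarrow> ('o, 'm) cat \<Rightarrow> ('i \<Rightarrow> 'o) \<Rightarrow> ('j \<Rightarrow> 'm) \<Rightarrow> 'o \<Rightarrow> ('i \<Rightarrow> 'm) \<Rightarrow> bool" where
  "is_cone J C F0 F1 N c \<longleftrightarrow> N \<in> Obj C \<and>
     (\<forall>i\<in>Obj J. c i \<in> hom C N (F0 i)) \<and>
     (\<forall>a\<in>Arr J. F1 a \<cdot>\<^bsub>C\<^esub> c (Dom J a) = c (Cod J a))"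

definition is_limit ::
    "('i, 'j) cat \<Rightarrow> ('o, 'm) cat \<Rightarrow> ('i \<Rightarrow> 'o) \<Rightarrow> ('j \<Rightarrow> 'm) \<Rightarrow> 'o \<Rightarrow> ('i \<Rightarrow> 'm) \<Rightarrow> bool" where
  "is_limit J C F0 F1 L l \<longleftrightarrow> is_cone J C F0 F1 L l \<and>
     (\<forall>N c. is_cone J C F0 F1 N c \<longrightarrow>
        (\<exists>!h. h \<in> hom C N L \<and> (\<forall>i\<in>Obj J. l i \<cdot>\<^bsub>C\<^esub> h = c i)))"

text \<open>Every finite category is isomorphic to one whose objects and arrows are natural
  numbers, so restricting the index categories to this type loses no finite diagram.\<close>

definition finitely_complete :: "('o, 'm) cat \<Rightarrow> bool" where
  "finitely_complete C \<longleftrightarrow> category C \<and>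
     (\<forall>(J :: (nat, nat) cat) F0 F1.
        category J \<and> finite (Obj J) \<and> finite (Arr J) \<and> is_functor J C F0 F1 \<longrightarrow>
        (\<exists>L l. is_limit J C F0 F1 L l))"

text \<open>\<open>is_pullback C f g p q\<close>: the square \<open>f p = g q\<close> is a pullback.\<close>

definition is_pullback :: "('o, 'm) cat \<Rightarrow> 'm \<Rightarrow> 'm \<Rightarrow> 'm \<Rightarrow> 'm \<Rightarrow> bool" where
  "is_pullback C f g p q \<longleftrightarrow>
     f \<in> Arr C \<and> g \<in> Arr C \<and> p \<in> Arr C \<and> q \<in> Arr C \<and>
     Cod C f = Cod C g \<and> Cod C p = Dom C f \<and> Cod C q = Dom C g \<and> Dom C p = Dom C q \<and>
     f \<cdot>\<^bsub>C\<^esub> p = g \<cdot>\<^bsub>C\<^esub> q \<and>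
     (\<forall>x\<in>Arr C. \<forall>y\<in>Arr C. Dom C x = Dom C y \<and> Cod C x = Dom C f \<and> Cod C y = Dom C g \<and>
        f \<cdot>\<^bsub>C\<^esub> x = g \<cdot>\<^bsub>C\<^esub> y \<longrightarrow>
        (\<exists>!h. h \<in> hom C (Dom C x) (Dom C p) \<and> p \<cdot>\<^bsub>C\<^esub> h = x \<and> q \<cdot>\<^bsub>C\<^esub> h = y))"

definition is_product :: "('o, 'm) cat \<Rightarrow> 'o \<Rightarrow> 'o \<Rightarrow> 'm \<Rightarrow> 'm \<Rightarrow> bool" where
  "is_product C A B p q \<longleftrightarrow>
     p \<in> Arr C \<and> q \<in> Arr C \<and> Dom C p = Dom C q \<and> Cod C p = A \<and> Cod C q = B \<and>
     (\<forall>x\<in>Arr C. \<forall>y\<in>Arr C. Dom C x = Dom C y \<and> Cod C x = A \<and> Cod C y = B \<longrightarrow>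
        (\<exists>!h. h \<in> hom C (Dom C x) (Dom C p) \<and> p \<cdot>\<^bsub>C\<^esub> h = x \<and> q \<cdot>\<^bsub>C\<^esub> h = y))"

text \<open>Pullbacks and binary products are chosen once and for all by Hilbert choice; they are
  meaningful as soon as a pullback, resp. product, exists.\<close>

definition pb :: "('o, 'm) cat \<Rightarrow> 'm \<Rightarrow> 'm \<Rightarrow> 'm \<times> 'm" where
  "pb C f g = (SOME (p, q). is_pullback C f g p q)"

definition projs :: "('o, 'm) cat \<Rightarrow> 'o \<Rightarrow> 'o \<Rightarrow> 'm \<times> 'm" where
  "projs C A B = (SOME (p, q). is_product C A B p q)"

abbreviation pr0 :: "('o, 'm) cat \<Rightarrow> 'o \<Rightarrow> 'o \<Rightarrow> 'm" where
  "pr0 C A B \<equiv> fst (projs C A B)"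

abbreviation pr1 :: "('o, 'm) cat \<Rightarrow> 'o \<Rightarrow> 'o \<Rightarrow> 'm" where
  "pr1 C A B \<equiv> snd (projs C A B)"

text \<open>The map \<open>(f, g)\<close> into the product of the codomains of \<open>f\<close> and \<open>g\<close>.\<close>

definition pairing :: "('o, 'm) cat \<Rightarrow> 'm \<Rightarrow> 'm \<Rightarrow> 'm" where
  "pairing C f g = (THE h. h \<in> hom C (Dom C f) (Dom C (pr0 C (Cod C f) (Cod C g))) \<and>
     pr0 C (Cod C f) (Cod C g) \<cdot>\<^bsub>C\<^esub> h = f \<and> pr1 C (Cod C f) (Cod C g) \<cdot>\<^bsub>C\<^esub> h = g)"

text \<open>\<open>square_map C u\<close> is \<open>u \<times> u\<close>.\<close>

definition square_map :: "('o, 'm) cat \<Rightarrow> 'm \<Rightarrow> 'm" where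
  "square_map C u =
     pairing C (u \<cdot>\<^bsub>C\<^esub> pr0 C (Dom C u) (Dom C u)) (u \<cdot>\<^bsub>C\<^esub> pr1 C (Dom C u) (Dom C u))"


section \<open>Internal equivalence relations\<close>

text \<open>A relation \<open>R\<close> on \<open>X\<close> is given by its two legs \<open>(d\<^sub>0, d\<^sub>1)\<close>; its underlying
  object is the common domain of the legs.\<close>

abbreviation (input) d0 :: "'m \<times> 'm \<Rightarrow> 'm" where "d0 \<equiv> fst"
abbreviation (input) d1 :: "'m \<times> 'm \<Rightarrow> 'm" where "d1 \<equiv> snd"

definition rel_obj :: "('o, 'm) cat \<Rightarrow> 'm \<times> 'm \<Rightarrow> 'o" where
  "rel_obj C R = Dom C (d0 R)"

definition relation :: "('o, 'm) cat \<Rightarrow> 'o \<Rightarrow> 'm \<times> 'm \<Rightarrow> bool" where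
  "relation C X R \<longleftrightarrow> d0 R \<in> hom C (rel_obj C R) X \<and> d1 R \<in> hom C (rel_obj C R) X \<and>
     monic C (pairing C (d0 R) (d1 R))"

definition is_reflexivity :: "('o, 'm) cat \<Rightarrow> 'o \<Rightarrow> 'm \<times> 'm \<Rightarrow> 'm \<Rightarrow> bool" where
  "is_reflexivity C X R s \<longleftrightarrow> s \<in> hom C X (rel_obj C R) \<and>
     d0 R \<cdot>\<^bsub>C\<^esub> s = Ide C X \<and> d1 R \<cdot>\<^bsub>C\<^esub> s = Ide C X"

definition equivalence :: "('o, 'm) cat \<Rightarrow> 'o \<Rightarrow> 'm \<times> 'm \<Rightarrow> bool" where
  "equivalence C X R \<longleftrightarrow> relation C X R \<and>
     (\<exists>s. is_reflexivity C X R s) \<and>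
     (\<exists>t\<in>hom C (rel_obj C R) (rel_obj C R). d0 R \<cdot>\<^bsub>C\<^esub> t = d1 R \<and> d1 R \<cdot>\<^bsub>C\<^esub> t = d0 R) \<and>
     (\<forall>p q. is_pullback C (d1 R) (d0 R) p q \<longrightarrow>
        (\<exists>t\<in>hom C (Dom C p) (rel_obj C R).
           d0 R \<cdot>\<^bsub>C\<^esub> t = d0 R \<cdot>\<^bsub>C\<^esub> p \<and> d1 R \<cdot>\<^bsub>C\<^esub> t = d1 R \<cdot>\<^bsub>C\<^esub> q))"

text \<open>Inclusion as subobjects of \<open>X \<times> X\<close>.\<close>

definition included :: "('o, 'm) cat \<Rightarrow> 'm \<times> 'm \<Rightarrow> 'm \<times> 'm \<Rightarrow> bool" where
  "included C R S \<longleftrightarrow>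
     (\<exists>h\<in>hom C (rel_obj C R) (rel_obj C S).
        pairing C (d0 S) (d1 S) \<cdot>\<^bsub>C\<^esub> h = pairing C (d0 R) (d1 R))"

definition is_largest_equivalence ::
    "('o, 'm) cat \<Rightarrow> 'o \<Rightarrow> ('m \<times> 'm \<Rightarrow> bool) \<Rightarrow> 'm \<times> 'm \<Rightarrow> bool" where
  "is_largest_equivalence C X P T \<longleftrightarrow> equivalence C X T \<and> P T \<and>
     (\<forall>T'. equivalence C X T' \<and> P T' \<longrightarrow> included C T' T)"

text \<open>In the following two definitions \<open>f : X \<rightarrow> Y\<close> is the map on the base objects and
  \<open>g : S \<rightarrow> R\<close> the map that the informal notation writes as \<open>f\<close> with a bar.\<close>

definition equ_morphism ::
    "('o, 'm) cat \<Rightarrow> 'm \<times> 'm \<Rightarrow> 'm \<times> 'm \<Rightarrow> 'm \<Rightarrow> 'm \<Rightarrow> bool" where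
  "equ_morphism C S R f g \<longleftrightarrow>
     f \<in> hom C (Cod C (d0 S)) (Cod C (d0 R)) \<and> g \<in> hom C (rel_obj C S) (rel_obj C R) \<and>
     d0 R \<cdot>\<^bsub>C\<^esub> g = f \<cdot>\<^bsub>C\<^esub> d0 S \<and> d1 R \<cdot>\<^bsub>C\<^esub> g = f \<cdot>\<^bsub>C\<^esub> d1 S"

definition fibrant ::
    "('o, 'm) cat \<Rightarrow> 'm \<times> 'm \<Rightarrow> 'm \<times> 'm \<Rightarrow> 'm \<Rightarrow> 'm \<Rightarrow> bool" where
  "fibrant C S R f g \<longleftrightarrow> equ_morphism C S R f g \<and> is_pullback C (d0 R) f g (d0 S)"

text \<open>The pullback of \<open>T \<rightarrow> X \<times> X\<close> along \<open>u \<times> u : U \<times> U \<rightarrow> X \<times> X\<close>, as a pair of legs to \<open>U\<close>.\<close>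

definition inverse_image :: "('o, 'm) cat \<Rightarrow> 'm \<Rightarrow> 'm \<times> 'm \<Rightarrow> 'm \<times> 'm" where
  "inverse_image C u T =
     (let w = fst (pb C (square_map C u) (pairing C (d0 T) (d1 T)))
      in (pr0 C (Dom C u) (Dom C u) \<cdot>\<^bsub>C\<^esub> w, pr1 C (Dom C u) (Dom C u) \<cdot>\<^bsub>C\<^esub> w))"

definition saturated :: "('o, 'm) cat \<Rightarrow> 'm \<Rightarrow> 'm \<times> 'm \<Rightarrow> bool" where
  "saturated C u T \<longleftrightarrow> (\<exists>g. fibrant C (inverse_image C u T) T u g)"

definition equ_saturating :: "('o, 'm) cat \<Rightarrow> bool" where
  "equ_saturating C \<longleftrightarrow>
     (\<forall>u S. monic C u \<and> equivalence C (Dom C u) S \<longrightarrow>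
        (\<exists>T. is_largest_equivalence C (Cod C u)
               (\<lambda>T. saturated C u T \<and> included C (inverse_image C u T) S) T))"


section \<open>Points and protomodularity\<close>

text \<open>The fibre over \<open>Y\<close> of the fibration of points. Its objects are split epimorphisms
  \<open>(f, s)\<close> with codomain \<open>Y\<close>; an arrow is a triple recording source, underlying map, target.\<close>

definition Pt :: "('o, 'm) cat \<Rightarrow> 'o \<Rightarrow> ('m \<times> 'm, ('m \<times> 'm) \<times> 'm \<times> ('m \<times> 'm)) cat" where
  "Pt C Y =
     (let points = {(f, s). f \<in> hom C (Dom C f) Y \<and> s \<in> hom C Y (Dom C f) \<and>
                            f \<cdot>\<^bsub>C\<^esub> s = Ide C Y}
      in \<lparr> Obj = points,
           Arr = {(P, h, Q). P \<in> points \<and> Q \<in> points \<and> h \<in> hom C (Dom C (fst P)) (Dom C (fst Q)) \<and>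
                             fst Q \<cdot>\<^bsub>C\<^esub> h = fst P \<and> h \<cdot>\<^bsub>C\<^esub> snd P = snd Q},
           Dom = (\<lambda>(P, h, Q). P),
           Cod = (\<lambda>(P, h, Q). Q),
           Ide = (\<lambda>P. (P, Ide C (Dom C (fst P)), P)),
           Comp = (\<lambda>(Q', k, R) (P, h, Q). (P, k \<cdot>\<^bsub>C\<^esub> h, R)) \<rparr>)"

text \<open>Base change along \<open>v\<close>, on objects and on arrows.\<close>

definition base_change_obj :: "('o, 'm) cat \<Rightarrow> 'm \<Rightarrow> 'm \<times> 'm \<Rightarrow> 'm \<times> 'm" where
  "base_change_obj C v P =
     (let (p, q) = pb C (fst P) v
      in (q, THE t. t \<in> hom C (Dom C v) (Dom C q) \<and>
                    p \<cdot>\<^bsub>C\<^esub> t = snd P \<cdot>\<^bsub>C\<^esub> v \<and> q \<cdot>\<^bsub>C\<^esub> t = Ide C (Dom C v)))"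

definition base_change_arr ::
    "('o, 'm) cat \<Rightarrow> 'm \<Rightarrow> ('m \<times> 'm) \<times> 'm \<times> ('m \<times> 'm) \<Rightarrow> ('m \<times> 'm) \<times> 'm \<times> ('m \<times> 'm)" where
  "base_change_arr C v a =
     (let (P, h, Q) = a; (p, q) = pb C (fst P) v; (p', q') = pb C (fst Q) v
      in (base_change_obj C v P,
          (THE k. k \<in> hom C (Dom C q) (Dom C q') \<and> p' \<cdot>\<^bsub>C\<^esub> k = h \<cdot>\<^bsub>C\<^esub> p \<and> q' \<cdot>\<^bsub>C\<^esub> k = q),
          base_change_obj C v Q))"

definition reflects_isos :: "('i, 'j) cat \<Rightarrow> ('o, 'm) cat \<Rightarrow> ('j \<Rightarrow> 'm) \<Rightarrow> bool" where
  "reflects_isos C D F \<longleftrightarrow> (\<forall>a\<in>Arr C. iso D (F a) \<longrightarrow> iso C a)"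

definition protomodular :: "('o, 'm) cat \<Rightarrow> bool" where
  "protomodular C \<longleftrightarrow>
     (\<forall>v\<in>Arr C. reflects_isos (Pt C (Cod C v)) (Pt C (Dom C v)) (base_change_arr C v))"


section \<open>Centralization\<close>

text \<open>\<open>[R, S] = 0\<close> for \<open>R\<close>, \<open>S\<close> on \<open>X\<close>. The double relation \<open>W\<close> is given by its legs \<open>V\<close> to \<open>R\<close>
  and its legs \<open>H\<close> to \<open>S\<close>.\<close>

definition centralize :: "('o, 'm) cat \<Rightarrow> 'o \<Rightarrow> 'm \<times> 'm \<Rightarrow> 'm \<times> 'm \<Rightarrow> bool" where
  "centralize C X R S \<longleftrightarrow>
     (\<exists>V H s z.
        rel_obj C V = rel_obj C H \<and>
        equivalence C (rel_obj C R) V \<and> equivalence C (rel_obj C S) H \<and>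
        is_reflexivity C X R s \<and> is_reflexivity C (rel_obj C S) H z \<and>
        equ_morphism C V S (d1 R) (d1 H) \<and>
        equ_morphism C S V s z \<and>
        fibrant C V S (d0 R) (d0 H))"

end

theory Submission
  imports Defs
begin

text \<open>Let \<open>s : X \<rightarrow> R\<close> be the reflexivity map, \<open>T = \<forall>\<^sub>s \<nabla>\<^sub>X\<close> and \<open>\<Sigma> = s\<inverse>T\<close>. If \<open>[R, S] = 0\<close>, then \<open>s\<close> is
  saturated with respect to the double relation on \<open>R\<close>, whose inverse image along \<open>s\<close> is \<open>S\<close>;
  hence \<open>S \<subseteq> \<Sigma>\<close>. Conversely, if \<open>s\<close> is saturated with respect to \<open>T\<close>, then the point \<open>T \<rightleftharpoons> R\<close>
  pulls back along \<open>s\<close> to \<open>\<Sigma> \<rightleftharpoons> X\<close>, so by protomodularity everything about \<open>T\<close> can be checked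
  on \<open>\<Sigma>\<close>: both legs of \<open>R\<close> carry \<open>T\<close> into \<open>\<Sigma>\<close>, the first one does so fibrantly, and the
  composition of \<open>R\<close> respects \<open>T\<close>. This makes \<open>T\<close> a double relation on \<open>R\<close> and \<open>\<Sigma>\<close>.\<close>

section \<open>Arrows of a category and of the fibres of points\<close>

lemma homD:
  assumes "f \<in> hom C A B"
  shows "f \<in> Arr C" "Dom C f = A" "Cod C f = B"
  using assms by (auto simp: hom_def)

lemma isoD:
  assumes "iso C h" "h \<in> hom C A B"
  obtains k where "k \<in> hom C B A" "k \<cdot>\<^bsub>C\<^esub> h = Ide C A" "h \<cdot>\<^bsub>C\<^esub> k = Ide C B"
  using assms by (auto simp: iso_def hom_def)

lemma Pt_simps:
  "Dom (Pt C Y) (P, h, Q) = P" "Cod (Pt C Y) (P, h, Q) = Q"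
  "Ide (Pt C Y) P = (P, Ide C (Dom C (fst P)), P)"
  "(Q, k, R) \<cdot>\<^bsub>Pt C Y\<^esub> (P, h, Q) = (P, k \<cdot>\<^bsub>C\<^esub> h, R)"
  by (simp_all add: Pt_def Let_def)

lemma Arr_Pt_iff:
  "(P, h, Q) \<in> Arr (Pt C Y) \<longleftrightarrow>
    fst P \<in> hom C (Dom C (fst P)) Y \<and> snd P \<in> hom C Y (Dom C (fst P)) \<and> fst P \<cdot>\<^bsub>C\<^esub> snd P = Ide C Y \<and>
    fst Q \<in> hom C (Dom C (fst Q)) Y \<and> snd Q \<in> hom C Y (Dom C (fst Q)) \<and> fst Q \<cdot>\<^bsub>C\<^esub> snd Q = Ide C Y \<and>
    h \<in> hom C (Dom C (fst P)) (Dom C (fst Q)) \<and> fst Q \<cdot>\<^bsub>C\<^esub> h = fst P \<and> h \<cdot>\<^bsub>C\<^esub> snd P = snd Q"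
  by (simp add: Pt_def Let_def case_prod_beta)

section \<open>Category laws as rewrite rules\<close>

locale finitely_complete_category =
  fixes C :: "('o, 'm) cat" (structure)
  assumes finitely_complete: "finitely_complete C"
begin

lemma category: "category C"
  using finitely_complete by (simp add: finitely_complete_def)

lemma Obj_Dom [simp]: "f \<in> Arr C \<Longrightarrow> Dom C f \<in> Obj C"
  and Obj_Cod [simp]: "f \<in> Arr C \<Longrightarrow> Cod C f \<in> Obj C"
  using category by (auto simp: category_def)

lemma Ide_hom: "A \<in> Obj C \<Longrightarrow> Ide C A \<in> hom C A A"
  using category by (auto simp: category_def)

lemma Ide_simps [simp]:
  assumes "A \<in> Obj C"
  shows "Ide C A \<in> Arr C" "Dom C (Ide C A) = A" "Cod C (Ide C A) = A"
  using homD[OF Ide_hom[OF assms]] by auto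

lemma hom_Obj:
  assumes "f \<in> hom C A B"
  shows "A \<in> Obj C" "B \<in> Obj C"
  using homD[OF assms] Obj_Dom[of f] Obj_Cod[of f] by auto

lemma comp_simps [simp]:
  assumes "f \<in> Arr C" "g \<in> Arr C" "Cod C f = Dom C g"
  shows "g \<cdot> f \<in> Arr C" "Dom C (g \<cdot> f) = Dom C f" "Cod C (g \<cdot> f) = Cod C g"
proof -
  have "g \<cdot> f \<in> hom C (Dom C f) (Cod C g)"
    using category assms by (auto simp: category_def)
  then show "g \<cdot> f \<in> Arr C" "Dom C (g \<cdot> f) = Dom C f" "Cod C (g \<cdot> f) = Cod C g"
    by (auto simp: hom_def)
qed

lemma comp_Ide [simp]: "f \<in> Arr C \<Longrightarrow> Dom C f = A \<Longrightarrow> f \<cdot> Ide C A = f"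
  and Ide_comp [simp]: "f \<in> Arr C \<Longrightarrow> Cod C f = A \<Longrightarrow> Ide C A \<cdot> f = f"
  using category by (auto simp: category_def)

lemma comp_assoc [simp]:
  assumes "f \<in> Arr C" "g \<in> Arr C" "h \<in> Arr C" "Cod C f = Dom C g" "Cod C g = Dom C h"
  shows "(h \<cdot> g) \<cdot> f = h \<cdot> (g \<cdot> f)"
  using category assms unfolding category_def by metis

text \<open>Because \<open>comp_assoc\<close> nests every composite to the right, an equation
  \<open>a \<cdot> b = c\<close> no longer matches inside \<open>a \<cdot> (b \<cdot> x)\<close>.
  This produces the form that does.\<close>

lemma comp_reassoc:
  assumes "a \<cdot> b = c" "a \<in> Arr C" "b \<in> Arr C" "Cod C b = Dom C a" "x \<in> Arr C" "Cod C x = Dom C b"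
  shows "a \<cdot> (b \<cdot> x) = c \<cdot> x"
  using assms by (metis comp_assoc)

section \<open>Pullbacks and products\<close>

lemma pullback_exists:
  assumes "f \<in> hom C A D" "g \<in> hom C B D"
  shows "\<exists>p q. is_pullback C f g p q"
proof -
  note fg [simp] = homD[OF assms(1)] homD[OF assms(2)]
  have [simp]: "A \<in> Obj C" "B \<in> Obj C" "D \<in> Obj C"
    using hom_Obj[OF assms(1)] hom_Obj[OF assms(2)] by auto
  \<comment> \<open>The cospan \<open>0 -> 2 <- 1\<close>: each object doubles as its identity, and
    3 and 4 are the two legs. If \<open>b\<close> is a leg, any \<open>a\<close> composable with it
    is an identity, so the composite is \<open>b\<close>.\<close>
  define J :: "(nat, nat) cat" where
    "J = \<lparr>Obj = {0, 1, 2}, Arr = {0, 1, 2, 3, 4},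
          Dom = (\<lambda>a. if a = 3 then 0 else if a = 4 then 1 else a),
          Cod = (\<lambda>a. if a = 3 \<or> a = 4 then 2 else a),
          Ide = (\<lambda>i. i), Comp = (\<lambda>b a. if b < 3 then a else b)\<rparr>"
  define F0 where "F0 i = (if i = 0 then A else if i = 1 then B else D)" for i :: nat
  define F1 where "F1 a = (if a = 3 then f else if a = 4 then g else Ide C (F0 a))" for a :: nat
  have "category J"
    by (auto simp: category_def J_def hom_def)
  moreover have "finite (Obj J)" "finite (Arr J)"
    by (auto simp: J_def)
  moreover have "is_functor J C F0 F1"
    by (auto simp: is_functor_def J_def F0_def F1_def hom_def)
  ultimately obtain L l where L: "is_limit J C F0 F1 L l"
    using finitely_complete unfolding finitely_complete_def by meson
  have cone_iff: "is_cone J C F0 F1 N c \<longleftrightarrow> c 0 \<in> hom C N A \<and> c 1 \<in> hom C N B \<and>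
      f \<cdot> c 0 = g \<cdot> c 1 \<and> c 2 = f \<cdot> c 0" for N c
    by (auto simp: is_cone_def J_def F0_def F1_def hom_def)
  have objs: "(\<forall>i\<in>Obj J. l i \<cdot> h = c i) \<longleftrightarrow> l 0 \<cdot> h = c 0 \<and> l 1 \<cdot> h = c 1 \<and> l 2 \<cdot> h = c 2" for h c
    by (auto simp: J_def)
  have l: "l 0 \<in> hom C L A" "l 1 \<in> hom C L B" "f \<cdot> l 0 = g \<cdot> l 1" "l 2 = f \<cdot> l 0"
    using L by (auto simp: is_limit_def cone_iff)
  note [simp] = homD[OF l(1)] homD[OF l(2)]
  have "is_pullback C f g (l 0) (l 1)"
    unfolding is_pullback_def
  proof (intro conjI ballI impI)
    fix x y
    assume xy: "x \<in> Arr C" "y \<in> Arr C"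
      and *: "Dom C x = Dom C y \<and> Cod C x = Dom C f \<and> Cod C y = Dom C g \<and> f \<cdot> x = g \<cdot> y"
    let ?c = "\<lambda>i::nat. if i = 0 then x else if i = 1 then y else f \<cdot> x"
    have "is_cone J C F0 F1 (Dom C x) ?c"
      using xy * by (auto simp: cone_iff hom_def)
    then have "\<exists>!h. h \<in> hom C (Dom C x) L \<and> (\<forall>i\<in>Obj J. l i \<cdot> h = ?c i)"
      using L by (simp add: is_limit_def)
    moreover have "h \<in> hom C (Dom C x) L \<and> (\<forall>i\<in>Obj J. l i \<cdot> h = ?c i) \<longleftrightarrow>
        h \<in> hom C (Dom C x) (Dom C (l 0)) \<and> l 0 \<cdot> h = x \<and> l 1 \<cdot> h = y" for h
      using l(4) by (auto simp: objs hom_def)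
    ultimately show "\<exists>!h. h \<in> hom C (Dom C x) (Dom C (l 0)) \<and> l 0 \<cdot> h = x \<and> l 1 \<cdot> h = y"
      by simp
  qed (use l in \<open>auto simp: hom_def\<close>)
  then show ?thesis by blast
qed

lemma product_exists:
  assumes [simp]: "A \<in> Obj C" "B \<in> Obj C"
  shows "\<exists>p q. is_product C A B p q"
proof -
  \<comment> \<open>The discrete category on two objects.\<close>
  define J :: "(nat, nat) cat" where
    "J = \<lparr>Obj = {0, 1}, Arr = {0, 1}, Dom = (\<lambda>a. a), Cod = (\<lambda>a. a),
          Ide = (\<lambda>i. i), Comp = (\<lambda>b a. a)\<rparr>"
  define F0 where "F0 i = (if i = 0 then A else B)" for i :: nat
  define F1 where "F1 a = Ide C (F0 a)" for a :: nat
  have "category J"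
    by (auto simp: category_def J_def hom_def)
  moreover have "finite (Obj J)" "finite (Arr J)"
    by (auto simp: J_def)
  moreover have "is_functor J C F0 F1"
    by (auto simp: is_functor_def J_def F0_def F1_def hom_def)
  ultimately obtain L l where L: "is_limit J C F0 F1 L l"
    using finitely_complete unfolding finitely_complete_def by meson
  have cone_iff: "is_cone J C F0 F1 N c \<longleftrightarrow> c 0 \<in> hom C N A \<and> c 1 \<in> hom C N B" for N c
    by (auto simp: is_cone_def J_def F0_def F1_def hom_def)
  have l: "l 0 \<in> hom C L A" "l 1 \<in> hom C L B"
    using L by (auto simp: is_limit_def cone_iff)
  note [simp] = homD[OF l(1)] homD[OF l(2)]
  have "is_product C A B (l 0) (l 1)"
    unfolding is_product_def
  proof (intro conjI ballI impI)
    fix x y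
    assume xy: "x \<in> Arr C" "y \<in> Arr C"
      and *: "Dom C x = Dom C y \<and> Cod C x = A \<and> Cod C y = B"
    let ?c = "\<lambda>i::nat. if i = 0 then x else y"
    have "is_cone J C F0 F1 (Dom C x) ?c"
      using xy * by (auto simp: cone_iff hom_def)
    then have "\<exists>!h. h \<in> hom C (Dom C x) L \<and> (\<forall>i\<in>Obj J. l i \<cdot> h = ?c i)"
      using L by (simp add: is_limit_def)
    moreover have "h \<in> hom C (Dom C x) L \<and> (\<forall>i\<in>Obj J. l i \<cdot> h = ?c i) \<longleftrightarrow>
        h \<in> hom C (Dom C x) (Dom C (l 0)) \<and> l 0 \<cdot> h = x \<and> l 1 \<cdot> h = y" for h
      by (auto simp: J_def)
    ultimately show "\<exists>!h. h \<in> hom C (Dom C x) (Dom C (l 0)) \<and> l 0 \<cdot> h = x \<and> l 1 \<cdot> h = y"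
      by simp
  qed (use l in \<open>auto simp: hom_def\<close>)
  then show ?thesis by blast
qed

lemma is_pullbackI:
  assumes "f \<in> hom C A D" "g \<in> hom C B D" "p \<in> hom C P A" "q \<in> hom C P B" "f \<cdot> p = g \<cdot> q"
    and "\<And>N x y. x \<in> hom C N A \<Longrightarrow> y \<in> hom C N B \<Longrightarrow> f \<cdot> x = g \<cdot> y \<Longrightarrow>
      \<exists>h\<in>hom C N P. p \<cdot> h = x \<and> q \<cdot> h = y"
    and "\<And>N h k. h \<in> hom C N P \<Longrightarrow> k \<in> hom C N P \<Longrightarrow> p \<cdot> h = p \<cdot> k \<Longrightarrow> q \<cdot> h = q \<cdot> k \<Longrightarrow> h = k"
  shows "is_pullback C f g p q"
  unfolding is_pullback_def
proof (intro conjI ballI impI)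
  fix x y
  assume "x \<in> Arr C" "y \<in> Arr C"
    and "Dom C x = Dom C y \<and> Cod C x = Dom C f \<and> Cod C y = Dom C g \<and> f \<cdot> x = g \<cdot> y"
  then have "x \<in> hom C (Dom C x) A" "y \<in> hom C (Dom C x) B" "f \<cdot> x = g \<cdot> y"
    using assms(1,2) by (auto simp: hom_def)
  from assms(6)[OF this] obtain h where h: "h \<in> hom C (Dom C x) P" "p \<cdot> h = x" "q \<cdot> h = y"
    by auto
  moreover have "Dom C p = P"
    using assms(3) by (simp add: hom_def)
  ultimately show "\<exists>!h. h \<in> hom C (Dom C x) (Dom C p) \<and> p \<cdot> h = x \<and> q \<cdot> h = y"
    using assms(7) by metis
qed (use assms(1-5) in \<open>auto simp: hom_def\<close>)

lemma pullback_square: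
  assumes "is_pullback C f g p q"
  shows "f \<in> Arr C" "g \<in> Arr C" "p \<in> Arr C" "q \<in> Arr C"
    "Cod C f = Cod C g" "Cod C p = Dom C f" "Cod C q = Dom C g" "Dom C p = Dom C q"
    "f \<cdot> p = g \<cdot> q"
  using assms by (auto simp: is_pullback_def)

lemma pullback_lift:
  assumes "is_pullback C f g p q" "x \<in> hom C N (Dom C f)" "y \<in> hom C N (Dom C g)" "f \<cdot> x = g \<cdot> y"
  obtains h where "h \<in> hom C N (Dom C q)" "p \<cdot> h = x" "q \<cdot> h = y"
proof -
  have "x \<in> Arr C" "y \<in> Arr C" "Dom C x = Dom C y" "Cod C x = Dom C f" "Cod C y = Dom C g" "Dom C x = N"
    using homD[OF assms(2)] homD[OF assms(3)] by simp_all
  moreover from this have "\<exists>!h. h \<in> hom C (Dom C x) (Dom C p) \<and> p \<cdot> h = x \<and> q \<cdot> h = y"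
    using assms(1,4) unfolding is_pullback_def by blast
  ultimately show ?thesis
    using that pullback_square(8)[OF assms(1)] by auto
qed

lemma pullback_unique:
  assumes pb: "is_pullback C f g p q" and h: "h \<in> hom C N (Dom C q)" and k: "k \<in> hom C N (Dom C q)"
    and eq: "p \<cdot> h = p \<cdot> k" "q \<cdot> h = q \<cdot> k"
  shows "h = k"
proof -
  note [simp] = pullback_square[OF pb] homD[OF h] homD[OF k]
  have "f \<cdot> (p \<cdot> h) = g \<cdot> (q \<cdot> h)"
    using comp_reassoc[OF pullback_square(9)[OF pb], of h] by simp
  moreover have "p \<cdot> h \<in> Arr C" "q \<cdot> h \<in> Arr C" "Dom C (p \<cdot> h) = Dom C (q \<cdot> h)"
    "Cod C (p \<cdot> h) = Dom C f" "Cod C (q \<cdot> h) = Dom C g"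
    by simp_all
  ultimately have "\<exists>!l. l \<in> hom C (Dom C (p \<cdot> h)) (Dom C p) \<and> p \<cdot> l = p \<cdot> h \<and> q \<cdot> l = q \<cdot> h"
    using pb unfolding is_pullback_def by blast
  moreover have "Dom C (p \<cdot> h) = N" "Dom C p = Dom C q"
    by simp_all
  ultimately show ?thesis
    using h k eq by metis
qed

lemma pb_is_pullback:
  assumes "f \<in> hom C A D" "g \<in> hom C B D"
  shows "is_pullback C f g (fst (pb C f g)) (snd (pb C f g))"
proof -
  obtain p q where "is_pullback C f g p q"
    using pullback_exists[OF assms] by blast
  then have "(\<lambda>(p, q). is_pullback C f g p q) (pb C f g)"
    unfolding pb_def by (intro someI[of "\<lambda>(p, q). is_pullback C f g p q" "(p, q)"]) simp
  then show ?thesis by (simp add: case_prod_beta)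
qed

lemma projs_is_product:
  assumes "A \<in> Obj C" "B \<in> Obj C"
  shows "is_product C A B (pr0 C A B) (pr1 C A B)"
proof -
  obtain p q where "is_product C A B p q"
    using product_exists[OF assms] by blast
  then have "(\<lambda>(p, q). is_product C A B p q) (projs C A B)"
    unfolding projs_def by (intro someI[of "\<lambda>(p, q). is_product C A B p q" "(p, q)"]) simp
  then show ?thesis by (simp add: case_prod_beta)
qed

lemma projs_simps [simp]:
  assumes "A \<in> Obj C" "B \<in> Obj C"
  shows "pr0 C A B \<in> Arr C" "pr1 C A B \<in> Arr C" "Dom C (pr1 C A B) = Dom C (pr0 C A B)"
    "Cod C (pr0 C A B) = A" "Cod C (pr1 C A B) = B"
  using projs_is_product[OF assms] by (auto simp: is_product_def)

lemma product_unique: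
  assumes "A \<in> Obj C" "B \<in> Obj C"
    and h: "h \<in> hom C N (Dom C (pr0 C A B))" and k: "k \<in> hom C N (Dom C (pr0 C A B))"
    and eq: "pr0 C A B \<cdot> h = pr0 C A B \<cdot> k" "pr1 C A B \<cdot> h = pr1 C A B \<cdot> k"
  shows "h = k"
proof -
  note [simp] = homD[OF h] assms(1,2)
  have "pr0 C A B \<cdot> h \<in> Arr C" "pr1 C A B \<cdot> h \<in> Arr C" "Dom C (pr0 C A B \<cdot> h) = Dom C (pr1 C A B \<cdot> h)"
    "Cod C (pr0 C A B \<cdot> h) = A" "Cod C (pr1 C A B \<cdot> h) = B"
    by simp_all
  then have "\<exists>!l. l \<in> hom C (Dom C (pr0 C A B \<cdot> h)) (Dom C (pr0 C A B)) \<and>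
      pr0 C A B \<cdot> l = pr0 C A B \<cdot> h \<and> pr1 C A B \<cdot> l = pr1 C A B \<cdot> h"
    using projs_is_product[OF assms(1,2)] unfolding is_product_def by blast
  moreover have "Dom C (pr0 C A B \<cdot> h) = N"
    using h assms(1,2) by (simp add: hom_def)
  ultimately show ?thesis
    using h k eq by metis
qed

lemma pairing:
  assumes "f \<in> hom C N A" "g \<in> hom C N B"
  shows "pairing C f g \<in> hom C N (Dom C (pr0 C A B))"
    "pr0 C A B \<cdot> pairing C f g = f" "pr1 C A B \<cdot> pairing C f g = g"
proof -
  note [simp] = homD[OF assms(1)] homD[OF assms(2)]
  have [simp]: "A \<in> Obj C" "B \<in> Obj C"
    using hom_Obj[OF assms(1)] hom_Obj[OF assms(2)] by auto
  have "\<exists>!h. h \<in> hom C (Dom C f) (Dom C (pr0 C A B)) \<and> pr0 C A B \<cdot> h = f \<and> pr1 C A B \<cdot> h = g"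
    using projs_is_product[of A B] homD[OF assms(1)] homD[OF assms(2)] unfolding is_product_def
    by (metis \<open>A \<in> Obj C\<close> \<open>B \<in> Obj C\<close>)
  from theI'[OF this]
  have "pairing C f g \<in> hom C N (Dom C (pr0 C A B)) \<and>
      pr0 C A B \<cdot> pairing C f g = f \<and> pr1 C A B \<cdot> pairing C f g = g"
    unfolding pairing_def by simp
  then show "pairing C f g \<in> hom C N (Dom C (pr0 C A B))"
    "pr0 C A B \<cdot> pairing C f g = f" "pr1 C A B \<cdot> pairing C f g = g" by auto
qed

text \<open>Equality of maps into a product is tested on the projections. The two pairings may have
  different domains, as in the cospan that defines \<open>inverse_image\<close>.\<close>

lemma pairing_comp_eq_iff:
  assumes "f \<in> hom C N A" "g \<in> hom C N B" "f' \<in> hom C M A" "g' \<in> hom C M B"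
    and "h \<in> hom C K N" "k \<in> hom C K M"
  shows "pairing C f g \<cdot> h = pairing C f' g' \<cdot> k \<longleftrightarrow> f \<cdot> h = f' \<cdot> k \<and> g \<cdot> h = g' \<cdot> k"
proof
  note P = pairing[OF assms(1,2)] and Q = pairing[OF assms(3,4)]
  note [simp] = homD[OF assms(1)] homD[OF assms(2)] homD[OF assms(5)] homD[OF assms(6)]
    homD[OF assms(3)] homD[OF assms(4)] homD[OF P(1)] homD[OF Q(1)]
  have [simp]: "A \<in> Obj C" "B \<in> Obj C"
    using hom_Obj[OF assms(1)] hom_Obj[OF assms(2)] by auto
  have [simp]: "pr0 C A B \<cdot> (pairing C f g \<cdot> h) = f \<cdot> h" "pr1 C A B \<cdot> (pairing C f g \<cdot> h) = g \<cdot> h"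
    "pr0 C A B \<cdot> (pairing C f' g' \<cdot> k) = f' \<cdot> k" "pr1 C A B \<cdot> (pairing C f' g' \<cdot> k) = g' \<cdot> k"
    by (simp_all add: comp_reassoc[OF P(2)] comp_reassoc[OF P(3)] comp_reassoc[OF Q(2)] comp_reassoc[OF Q(3)])
  show "f \<cdot> h = f' \<cdot> k \<and> g \<cdot> h = g' \<cdot> k" if "pairing C f g \<cdot> h = pairing C f' g' \<cdot> k"
    using that by (metis \<open>pr0 C A B \<cdot> (pairing C f g \<cdot> h) = f \<cdot> h\<close> \<open>pr1 C A B \<cdot> (pairing C f g \<cdot> h) = g \<cdot> h\<close>
        \<open>pr0 C A B \<cdot> (pairing C f' g' \<cdot> k) = f' \<cdot> k\<close> \<open>pr1 C A B \<cdot> (pairing C f' g' \<cdot> k) = g' \<cdot> k\<close>)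
  show "pairing C f g \<cdot> h = pairing C f' g' \<cdot> k" if "f \<cdot> h = f' \<cdot> k \<and> g \<cdot> h = g' \<cdot> k"
    by (rule product_unique[of A B _ K]) (use that in \<open>simp_all add: hom_def\<close>)
qed

lemma monicD:
  assumes "monic C m" "h \<in> hom C N (Dom C m)" "k \<in> hom C N (Dom C m)" "m \<cdot> h = m \<cdot> k"
  shows "h = k"
  using assms unfolding monic_def hom_def by auto

lemma monicI:
  assumes "m \<in> hom C A B"
    and "\<And>N h k. h \<in> hom C N A \<Longrightarrow> k \<in> hom C N A \<Longrightarrow> m \<cdot> h = m \<cdot> k \<Longrightarrow> h = k"
  shows "monic C m"
  unfolding monic_def
proof (intro conjI ballI impI)
  fix f g
  assume "f \<in> Arr C" "g \<in> Arr C"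
    "Dom C f = Dom C g \<and> Cod C f = Dom C m \<and> Cod C g = Dom C m \<and> m \<cdot> f = m \<cdot> g"
  then show "f = g"
    using assms(1) by (intro assms(2)[of f "Dom C f" g]) (auto simp: hom_def)
qed (use assms(1) in \<open>simp add: hom_def\<close>)

text \<open>Turns the invertibility of a comparison map into the statement that the compared square
  is itself a pullback.\<close>

lemma pullback_iso:
  assumes pb: "is_pullback C f g p q" and "iso C h" and h: "h \<in> hom C N (Dom C q)"
  shows "is_pullback C f g (p \<cdot> h) (q \<cdot> h)"
proof -
  obtain k where k: "k \<in> hom C (Dom C q) N" "k \<cdot> h = Ide C N" "h \<cdot> k = Ide C (Dom C q)"
    by (rule isoD[OF assms(2) h])
  note s [simp] = pullback_square[OF pb] homD[OF h] homD[OF k(1)]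
  note r [simp] = comp_reassoc[OF pullback_square(9)[OF pb]] comp_reassoc[OF k(2)] comp_reassoc[OF k(3)]
  have [simp]: "N \<in> Obj C" using hom_Obj[OF h] by simp
  show ?thesis
  proof (rule is_pullbackI[of f "Dom C f" "Cod C f" g "Dom C g" _ N])
    fix M x y assume xy: "x \<in> hom C M (Dom C f)" "y \<in> hom C M (Dom C g)" "f \<cdot> x = g \<cdot> y"
    obtain l where l: "l \<in> hom C M (Dom C q)" "p \<cdot> l = x" "q \<cdot> l = y"
      by (rule pullback_lift[OF pb xy])
    note [simp] = homD[OF l(1)]
    show "\<exists>h'\<in>hom C M N. (p \<cdot> h) \<cdot> h' = x \<and> (q \<cdot> h) \<cdot> h' = y"
      by (rule bexI[of _ "k \<cdot> l"]) (use l in \<open>simp_all add: hom_def\<close>)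
  next
    fix M a b assume a: "a \<in> hom C M N" and b: "b \<in> hom C M N"
      and e: "(p \<cdot> h) \<cdot> a = (p \<cdot> h) \<cdot> b" "(q \<cdot> h) \<cdot> a = (q \<cdot> h) \<cdot> b"
    note [simp] = homD[OF a] homD[OF b]
    have "h \<cdot> a = h \<cdot> b"
      by (rule pullback_unique[OF pb, of _ M]) (use e in \<open>simp_all add: hom_def\<close>)
    then have "k \<cdot> (h \<cdot> a) = k \<cdot> (h \<cdot> b)" by simp
    then show "a = b" by simp
  qed (simp_all add: hom_def)
qed

section \<open>Generalized elements of relations\<close>

text \<open>Relations in terms of generalized elements: the pair \<open>(x, y)\<close> factors
  through \<open>R\<close>. The stage is not a parameter, since it is the domain of the factor
  \<open>h\<close>; this keeps elementwise arguments free of bookkeeping.\<close>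

definition related :: "'m \<times> 'm \<Rightarrow> 'm \<Rightarrow> 'm \<Rightarrow> bool" where
  "related R x y \<longleftrightarrow> (\<exists>h\<in>Arr C. Cod C h = rel_obj C R \<and> d0 R \<cdot> h = x \<and> d1 R \<cdot> h = y)"

lemma relation_simps:
  assumes "relation C X R"
  shows "fst R \<in> Arr C" "snd R \<in> Arr C" "Dom C (fst R) = rel_obj C R" "Dom C (snd R) = rel_obj C R"
    "Cod C (fst R) = X" "Cod C (snd R) = X" "rel_obj C R \<in> Obj C" "X \<in> Obj C"
proof -
  show "fst R \<in> Arr C" "snd R \<in> Arr C" "Dom C (fst R) = rel_obj C R" "Dom C (snd R) = rel_obj C R"
    "Cod C (fst R) = X" "Cod C (snd R) = X"
    using assms by (auto simp: relation_def hom_def)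
  then show "rel_obj C R \<in> Obj C" "X \<in> Obj C"
    using Obj_Dom[of "fst R"] Obj_Cod[of "fst R"] by auto
qed

lemma relation_unique:
  assumes R: "relation C X R"
    and h: "h \<in> hom C N (rel_obj C R)" and k: "k \<in> hom C N (rel_obj C R)"
    and eq: "fst R \<cdot> h = fst R \<cdot> k" "snd R \<cdot> h = snd R \<cdot> k"
  shows "h = k"
proof -
  have legs: "fst R \<in> hom C (rel_obj C R) X" "snd R \<in> hom C (rel_obj C R) X"
    using R by (auto simp: relation_def)
  show ?thesis
  proof (rule monicD[of "pairing C (fst R) (snd R)" _ N])
    show "monic C (pairing C (fst R) (snd R))"
      using R by (simp add: relation_def)
    show "pairing C (fst R) (snd R) \<cdot> h = pairing C (fst R) (snd R) \<cdot> k"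
      using pairing_comp_eq_iff[OF legs legs h k] eq by simp
  qed (use h k homD(2)[OF pairing(1)[OF legs]] in simp_all)
qed

lemma relationI:
  assumes a: "a \<in> hom C W X" and b: "b \<in> hom C W X"
    and mono: "\<And>N h k. h \<in> hom C N W \<Longrightarrow> k \<in> hom C N W \<Longrightarrow> a \<cdot> h = a \<cdot> k \<Longrightarrow> b \<cdot> h = b \<cdot> k \<Longrightarrow> h = k"
  shows "relation C X (a, b)" "rel_obj C (a, b) = W"
proof -
  show W: "rel_obj C (a, b) = W"
    using a by (simp add: rel_obj_def hom_def)
  have "monic C (pairing C a b)"
    by (rule monicI[OF pairing(1)[OF a b]]) (use pairing_comp_eq_iff[OF a b a b] mono in metis)
  then show "relation C X (a, b)"
    using a b W by (simp add: relation_def)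
qed

section \<open>Calculus of related pairs\<close>

lemma relatedE:
  assumes "related R x y" "relation C X R" "Dom C x = N"
  obtains h where "h \<in> hom C N (rel_obj C R)" "fst R \<cdot> h = x" "snd R \<cdot> h = y"
    "x \<in> hom C N X" "y \<in> hom C N X"
proof -
  note [simp] = relation_simps[OF assms(2)]
  obtain h where "h \<in> Arr C" "Cod C h = rel_obj C R" "fst R \<cdot> h = x" "snd R \<cdot> h = y"
    using assms(1) by (auto simp: related_def)
  then show ?thesis
    using assms(3) by (intro that[of h]) (auto simp: hom_def)
qed

lemma relatedI:
  assumes "h \<in> hom C N (rel_obj C R)" "fst R \<cdot> h = x" "snd R \<cdot> h = y"
  shows "related R x y"
  using assms by (auto simp: related_def hom_def)

lemma related_comp:
  assumes "related R x y" "relation C X R" "k \<in> hom C B (Dom C x)"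
  shows "related R (x \<cdot> k) (y \<cdot> k)"
proof -
  obtain h where h: "h \<in> hom C (Dom C x) (rel_obj C R)" "fst R \<cdot> h = x" "snd R \<cdot> h = y"
    by (rule relatedE[OF assms(1,2) refl])
  note [simp] = relation_simps[OF assms(2)] homD[OF h(1)] homD[OF assms(3)]
    comp_reassoc[OF h(2)] comp_reassoc[OF h(3)]
  show ?thesis
    by (rule relatedI[of "h \<cdot> k" B]) (simp_all add: hom_def)
qed

text \<open>The generic related pair: a property of all related pairs, applied to it, yields an
  internal map out of the object of \<open>R\<close>.\<close>

lemma related_legs:
  assumes "relation C X R"
  shows "related R (fst R) (snd R)"
  by (rule relatedI[of "Ide C (rel_obj C R)" "rel_obj C R"])
    (use relation_simps[OF assms] in \<open>simp_all add: hom_def\<close>)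

lemma equivalence_relation: "equivalence C X R \<Longrightarrow> relation C X R"
  by (simp add: equivalence_def)

lemma related_refl:
  assumes R: "equivalence C X R" and x: "x \<in> hom C N X"
  shows "related R x x"
proof -
  obtain s where s: "s \<in> hom C X (rel_obj C R)" "fst R \<cdot> s = Ide C X" "snd R \<cdot> s = Ide C X"
    using R by (auto simp: equivalence_def is_reflexivity_def)
  note [simp] = relation_simps[OF equivalence_relation[OF R]] homD[OF s(1)] homD[OF x]
    comp_reassoc[OF s(2)] comp_reassoc[OF s(3)]
  show ?thesis
    by (rule relatedI[of "s \<cdot> x" N]) (simp_all add: hom_def)
qed

lemma related_sym:
  assumes R: "equivalence C X R" and xy: "related R x y"
  shows "related R y x"
proof -
  obtain t where t: "t \<in> hom C (rel_obj C R) (rel_obj C R)" "fst R \<cdot> t = snd R" "snd R \<cdot> t = fst R"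
    using R by (auto simp: equivalence_def)
  obtain h where h: "h \<in> hom C (Dom C x) (rel_obj C R)" "fst R \<cdot> h = x" "snd R \<cdot> h = y"
    by (rule relatedE[OF xy equivalence_relation[OF R] refl])
  note [simp] = relation_simps[OF equivalence_relation[OF R]] homD[OF t(1)] homD[OF h(1)] h(2,3)
    comp_reassoc[OF t(2)] comp_reassoc[OF t(3)]
  show ?thesis
    by (rule relatedI[of "t \<cdot> h" "Dom C x"]) (simp_all add: hom_def)
qed

lemma related_trans:
  assumes R: "equivalence C X R" and xy: "related R x y" and yz: "related R y z"
  shows "related R x z"
proof -
  note rel = equivalence_relation[OF R]
  obtain h where h: "h \<in> hom C (Dom C x) (rel_obj C R)" "fst R \<cdot> h = x" "snd R \<cdot> h = y"
    by (rule relatedE[OF xy rel refl])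
  obtain k where k: "k \<in> hom C (Dom C y) (rel_obj C R)" "fst R \<cdot> k = y" "snd R \<cdot> k = z"
    by (rule relatedE[OF yz rel refl])
  note [simp] = relation_simps[OF rel] homD[OF h(1)] homD[OF k(1)] h(2,3) k(2,3)
  have [simp]: "Dom C y = Dom C x"
    using h(3)[symmetric] by (simp del: h)
  obtain p q where pq: "is_pullback C (snd R) (fst R) p q"
    using pullback_exists[of "snd R" "rel_obj C R" X "fst R" "rel_obj C R"] by (auto simp: hom_def)
  note [simp] = pullback_square[OF pq]
  obtain t where t: "t \<in> hom C (Dom C p) (rel_obj C R)" "fst R \<cdot> t = fst R \<cdot> p" "snd R \<cdot> t = snd R \<cdot> q"
    using R pq unfolding equivalence_def by blast
  obtain l where l: "l \<in> hom C (Dom C x) (Dom C q)" "p \<cdot> l = h" "q \<cdot> l = k"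
    by (rule pullback_lift[OF pq, of h "Dom C x" k]) (auto simp: hom_def)
  note [simp] = homD[OF l(1)] l(2,3) homD[OF t(1)] comp_reassoc[OF t(2)] comp_reassoc[OF t(3)]
  show ?thesis
    by (rule relatedI[of "t \<cdot> l" "Dom C x"]) (simp_all add: hom_def)
qed

text \<open>Reflexivity is asked only at the generic element \<open>Ide C X\<close> and spreads to
  every stage by composition. Together with the Euclidean law it gives symmetry, and then
  transitivity. The internal maps come from the generic pair and from the generic composable pair
  \<open>(p, q)\<close>.\<close>

lemma equivalenceI:
  assumes R: "relation C X R"
    and Ide: "related R (Ide C X) (Ide C X)"
    and euclid: "\<And>x y z. related R x y \<Longrightarrow> related R x z \<Longrightarrow> related R y z"
  shows "equivalence C X R"
proof -
  note [simp] = relation_simps[OF R]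
  have refl': "related R x x" if x: "x \<in> hom C N X" for x N
    using related_comp[OF Ide R, of x N] x homD[OF x] by simp
  have sym: "related R y x" if "related R x y" for x y
    
  proof -
    have "x \<in> hom C (Dom C x) X"
      by (rule relatedE[OF that R refl])
    then show ?thesis
      by (rule euclid[OF that refl'])
  qed
  have trans: "related R x z" if "related R x y" "related R y z" for x y z
    using that sym euclid by blast
  have "\<exists>s. is_reflexivity C X R s"
    using Ide R by (auto simp: is_reflexivity_def elim!: relatedE[of R "Ide C X" _ X X])
  moreover have "\<exists>t\<in>hom C (rel_obj C R) (rel_obj C R). fst R \<cdot> t = snd R \<and> snd R \<cdot> t = fst R"
    by (rule relatedE[OF sym[OF related_legs[OF R]] R, of "rel_obj C R"]) auto
  moreover have "\<exists>t\<in>hom C (Dom C p) (rel_obj C R). fst R \<cdot> t = fst R \<cdot> p \<and> snd R \<cdot> t = snd R \<cdot> q"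
    if pq: "is_pullback C (snd R) (fst R) p q" for p q
  proof -
    note [simp] = pullback_square[OF pq]
    have "related R (fst R \<cdot> p) (snd R \<cdot> p)"
      by (rule relatedI[of p "Dom C p"]) (simp_all add: hom_def)
    moreover have "related R (fst R \<cdot> q) (snd R \<cdot> q)"
      by (rule relatedI[of q "Dom C q"]) (simp_all add: hom_def)
    ultimately have "related R (fst R \<cdot> p) (snd R \<cdot> q)"
      using trans by simp
    from relatedE[OF this R, of "Dom C p"] show ?thesis
      by auto
  qed
  ultimately show ?thesis
    using R by (auto simp: equivalence_def)
qed

section \<open>Inclusion and inverse images in terms of related pairs\<close>

lemma includedI:
  assumes R: "relation C X R" and S: "relation C X S" and "related S (fst R) (snd R)"
  shows "included C R S"
proof -
  note [simp] = relation_simps[OF R] relation_simps[OF S]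
  obtain h where h: "h \<in> hom C (rel_obj C R) (rel_obj C S)" "fst S \<cdot> h = fst R" "snd S \<cdot> h = snd R"
    by (rule relatedE[OF assms(3) S, of "rel_obj C R"]) simp_all
  have l: "fst R \<in> hom C (rel_obj C R) X" "snd R \<in> hom C (rel_obj C R) X"
    "fst S \<in> hom C (rel_obj C S) X" "snd S \<in> hom C (rel_obj C S) X"
    by (auto simp: hom_def)
  note [simp] = homD[OF pairing(1)[OF l(1,2)]]
  have "pairing C (fst S) (snd S) \<cdot> h = pairing C (fst R) (snd R) \<cdot> Ide C (rel_obj C R)"
    by (subst pairing_comp_eq_iff[OF l(3,4,1,2) h(1) Ide_hom]) (simp_all add: h)
  then show ?thesis
    using h(1) unfolding included_def by (intro bexI[of _ h]) simp_all
qed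

lemma includedD:
  assumes R: "relation C X R" and S: "relation C X S" and "included C R S" and "related R x y"
  shows "related S x y"
proof -
  note [simp] = relation_simps[OF R] relation_simps[OF S]
  obtain h where h: "h \<in> hom C (rel_obj C R) (rel_obj C S)"
    and eq: "pairing C (fst S) (snd S) \<cdot> h = pairing C (fst R) (snd R)"
    using assms(3) by (auto simp: included_def)
  have l: "fst R \<in> hom C (rel_obj C R) X" "snd R \<in> hom C (rel_obj C R) X"
    "fst S \<in> hom C (rel_obj C S) X" "snd S \<in> hom C (rel_obj C S) X"
    by (auto simp: hom_def)
  note [simp] = homD[OF pairing(1)[OF l(1,2)]] homD[OF h]
  have eqs: "fst S \<cdot> h = fst R" "snd S \<cdot> h = snd R"
    using pairing_comp_eq_iff[OF l(3,4,1,2) h Ide_hom] eq by simp_all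
  obtain k where k: "k \<in> hom C (Dom C x) (rel_obj C R)" "fst R \<cdot> k = x" "snd R \<cdot> k = y"
    by (rule relatedE[OF assms(4) R refl])
  note [simp] = homD[OF k(1)] comp_reassoc[OF eqs(1)] comp_reassoc[OF eqs(2)]
  show ?thesis
    by (rule relatedI[of "h \<cdot> k" "Dom C x"]) (simp_all add: hom_def k)
qed

text \<open>A map into the pullback of \<open>T\<close> along \<open>u \<times> u\<close> amounts to
  two maps \<open>x\<close>, \<open>y\<close> into \<open>U\<close> whose images under
  \<open>u\<close> are related by \<open>T\<close>. This description replaces the chosen pullback in
  everything that follows.\<close>

lemma inverse_image:
  assumes T: "relation C X T" and u: "u \<in> hom C U X"
  shows relation_inverse_image: "relation C U (inverse_image C u T)"
    and related_inverse_image_iff: "x \<in> hom C N U \<Longrightarrow> y \<in> hom C N U \<Longrightarrow>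
      related (inverse_image C u T) x y \<longleftrightarrow> related T (u \<cdot> x) (u \<cdot> y)"
proof -
  note [simp] = relation_simps[OF T] homD[OF u]
  have [simp]: "U \<in> Obj C"
    using hom_Obj[OF u] by simp
  define P where "P = Dom C (pr0 C U U)"
  have P [simp]: "Dom C (pr0 C U U) = P" by (simp add: P_def)
  have a: "u \<cdot> pr0 C U U \<in> hom C P X" "u \<cdot> pr1 C U U \<in> hom C P X"
    and T_legs: "fst T \<in> hom C (rel_obj C T) X" "snd T \<in> hom C (rel_obj C T) X"
    by (auto simp: hom_def)
  define sq where "sq = square_map C u"
  have sq_eq: "sq = pairing C (u \<cdot> pr0 C U U) (u \<cdot> pr1 C U U)"
    by (simp add: sq_def square_map_def)
  have sq: "sq \<in> hom C P (Dom C (pr0 C X X))"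
    using pairing(1)[OF a] by (simp add: sq_eq)
  define w where "w = fst (pb C sq (pairing C (fst T) (snd T)))"
  define q where "q = snd (pb C sq (pairing C (fst T) (snd T)))"
  have wq: "is_pullback C sq (pairing C (fst T) (snd T)) w q"
    unfolding w_def q_def by (rule pb_is_pullback[OF sq pairing(1)[OF T_legs]])
  have inv: "inverse_image C u T = (pr0 C U U \<cdot> w, pr1 C U U \<cdot> w)"
    by (simp add: inverse_image_def Let_def w_def sq_def)
  \<comment> \<open>The cone condition over this cospan splits into one equation per
    coordinate.\<close>
  have commute_iff: "sq \<cdot> h = pairing C (fst T) (snd T) \<cdot> k \<longleftrightarrow>
      u \<cdot> (pr0 C U U \<cdot> h) = fst T \<cdot> k \<and> u \<cdot> (pr1 C U U \<cdot> h) = snd T \<cdot> k"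
    if "h \<in> hom C N P" "k \<in> hom C N (rel_obj C T)" for h k N
    using pairing_comp_eq_iff[OF a T_legs that] homD[OF that(1)] by (simp add: sq_eq)
  define W where "W = Dom C q"
  have [simp]: "w \<in> Arr C" "q \<in> Arr C" "Dom C w = W" "Dom C q = W" "Cod C w = P" "Cod C q = rel_obj C T"
    using pullback_square[OF wq] homD[OF sq] homD[OF pairing(1)[OF T_legs]] by (simp_all add: W_def)
  have q_eq: "u \<cdot> (pr0 C U U \<cdot> w) = fst T \<cdot> q" "u \<cdot> (pr1 C U U \<cdot> w) = snd T \<cdot> q"
    using commute_iff[of w W q] pullback_square(9)[OF wq] by (simp_all add: hom_def)
  have q_eq': "u \<cdot> (pr0 C U U \<cdot> (w \<cdot> h)) = fst T \<cdot> (q \<cdot> h)" "u \<cdot> (pr1 C U U \<cdot> (w \<cdot> h)) = snd T \<cdot> (q \<cdot> h)"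
    if "h \<in> hom C N W" for h N
    using comp_reassoc[OF q_eq(1), of h] comp_reassoc[OF q_eq(2), of h] homD[OF that] by simp_all
  have legs: "pr0 C U U \<cdot> w \<in> hom C W U" "pr1 C U U \<cdot> w \<in> hom C W U"
    by (simp_all add: hom_def)
  have mono: "h = k"
    if h: "h \<in> hom C N W" and k: "k \<in> hom C N W"
      and eq: "(pr0 C U U \<cdot> w) \<cdot> h = (pr0 C U U \<cdot> w) \<cdot> k" "(pr1 C U U \<cdot> w) \<cdot> h = (pr1 C U U \<cdot> w) \<cdot> k"
    for N h k
  proof -
    note [simp] = homD[OF h] homD[OF k]
    have eq': "pr0 C U U \<cdot> (w \<cdot> h) = pr0 C U U \<cdot> (w \<cdot> k)" "pr1 C U U \<cdot> (w \<cdot> h) = pr1 C U U \<cdot> (w \<cdot> k)"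
      using eq by simp_all
    have w: "w \<cdot> h = w \<cdot> k"
      by (rule product_unique[of U U _ N]) (use eq' in \<open>simp_all add: hom_def\<close>)
    \<comment> \<open>The component in \<open>T\<close> is forced by the component in
      \<open>U \<times> U\<close>, because the legs of \<open>T\<close> are jointly monic.\<close>
    have "q \<cdot> h = q \<cdot> k"
      by (rule relation_unique[OF T, of _ N])
        (use q_eq'[OF h] q_eq'[OF k] eq' in \<open>simp_all add: hom_def\<close>)
    with w show "h = k"
      by (intro pullback_unique[OF wq, of h N k]) (simp_all add: hom_def)
  qed
  note rel = relationI[OF legs mono]
  show rel_inv: "relation C U (inverse_image C u T)"
    using rel(1) by (simp add: inv)
  have obj: "rel_obj C (inverse_image C u T) = W"
    using rel(2) by (simp add: inv)
  show "related (inverse_image C u T) x y \<longleftrightarrow> related T (u \<cdot> x) (u \<cdot> y)"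
    if x: "x \<in> hom C N U" and y: "y \<in> hom C N U"
  proof
    note [simp] = homD[OF x] homD[OF y]
    assume "related (inverse_image C u T) x y"
    then obtain h where h: "h \<in> hom C N W" "(pr0 C U U \<cdot> w) \<cdot> h = x" "(pr1 C U U \<cdot> w) \<cdot> h = y"
      using relatedE[OF _ rel_inv, of x y N] obj by (auto simp: inv)
    note [simp] = homD[OF h(1)]
    have "pr0 C U U \<cdot> (w \<cdot> h) = x" "pr1 C U U \<cdot> (w \<cdot> h) = y"
      using h by simp_all
    then show "related T (u \<cdot> x) (u \<cdot> y)"
      using q_eq'[OF h(1)] by (intro relatedI[of "q \<cdot> h" N]) (simp_all add: hom_def)
  next
    note [simp] = homD[OF x] homD[OF y]
    assume "related T (u \<cdot> x) (u \<cdot> y)"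
    then obtain k where k: "k \<in> hom C N (rel_obj C T)" "fst T \<cdot> k = u \<cdot> x" "snd T \<cdot> k = u \<cdot> y"
      by (rule relatedE[OF _ T, of _ _ N]) simp_all
    note z = pairing[OF x y]
    have "sq \<cdot> pairing C x y = pairing C (fst T) (snd T) \<cdot> k"
      using z k by (subst commute_iff[of _ N]) simp_all
    moreover have "pairing C x y \<in> hom C N (Dom C sq)" "k \<in> hom C N (Dom C (pairing C (fst T) (snd T)))"
      using z(1) k(1) homD[OF sq] homD[OF pairing(1)[OF T_legs]] by simp_all
    ultimately obtain h where h: "h \<in> hom C N W" "w \<cdot> h = pairing C x y"
      using pullback_lift[OF wq, of "pairing C x y" N k] unfolding W_def by blast
    note [simp] = homD[OF h(1)] h(2) z(2,3)
    show "related (inverse_image C u T) x y"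
      by (rule relatedI[of h N]) (simp_all add: obj h(1), simp_all add: inv)
  qed
qed

lemma equivalence_inverse_image:
  assumes T: "equivalence C X T" and u: "u \<in> hom C U X"
  shows "equivalence C U (inverse_image C u T)"
proof (rule equivalenceI)
  note rT = equivalence_relation[OF T]
  note rI = relation_inverse_image[OF rT u]
  note iff = related_inverse_image_iff[OF rT u]
  show "relation C U (inverse_image C u T)" by (rule rI)
  have "U \<in> Obj C"
    using hom_Obj[OF u] by simp
  then show "related (inverse_image C u T) (Ide C U) (Ide C U)"
    using iff[OF Ide_hom Ide_hom] u by (simp add: homD[OF u] related_refl[OF T u])
  fix x y z
  assume xy: "related (inverse_image C u T) x y" and xz: "related (inverse_image C u T) x z"
  obtain N where N: "x \<in> hom C N U" "y \<in> hom C N U" "z \<in> hom C N U"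
    using relatedE[OF xy rI refl] relatedE[OF xz rI refl] by metis
  have "related T (u \<cdot> x) (u \<cdot> y)" "related T (u \<cdot> x) (u \<cdot> z)"
    using iff[OF N(1,2)] iff[OF N(1,3)] xy xz by auto
  then have "related T (u \<cdot> y) (u \<cdot> z)"
    using related_sym[OF T] related_trans[OF T] by blast
  then show "related (inverse_image C u T) y z"
    using iff[OF N(2,3)] by auto
qed

text \<open>Fibrancy as unique lifting: a pair \<open>f \<cdot> x\<close>, \<open>y\<close> related
  by \<open>R\<close> comes from exactly one \<open>z\<close> with \<open>x\<close>,
  \<open>z\<close> related by \<open>S\<close>. Such a \<open>z\<close> supplies the lift in the
  pullback square, and joint monicity of the legs of \<open>R\<close> identifies its image under
  \<open>g\<close>.\<close>

lemma fibrantI: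
  assumes S: "relation C X S" and R: "relation C Y R" and f: "f \<in> hom C X Y"
    and g: "g \<in> hom C (rel_obj C S) (rel_obj C R)" "fst R \<cdot> g = f \<cdot> fst S" "snd R \<cdot> g = f \<cdot> snd S"
    and ex: "\<And>x y. x \<in> hom C (Dom C x) X \<Longrightarrow> related R (f \<cdot> x) y \<Longrightarrow> \<exists>z. related S x z \<and> f \<cdot> z = y"
    and uniq: "\<And>x z z'. related S x z \<Longrightarrow> related S x z' \<Longrightarrow> f \<cdot> z = f \<cdot> z' \<Longrightarrow> z = z'"
  shows "fibrant C S R f g"
  unfolding fibrant_def
proof
  note s [simp] = relation_simps[OF R] relation_simps[OF S] homD[OF f] homD[OF g(1)]
  note r [simp] = comp_reassoc[OF g(2)] comp_reassoc[OF g(3)]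
  show "equ_morphism C S R f g"
    using f g by (simp add: equ_morphism_def)
  show "is_pullback C (fst R) f g (fst S)"
  proof (rule is_pullbackI[of _ "rel_obj C R" Y _ X _ "rel_obj C S"])
    fix N a x assume a: "a \<in> hom C N (rel_obj C R)" and x: "x \<in> hom C N X" and eq: "fst R \<cdot> a = f \<cdot> x"
    note [simp] = homD[OF a] homD[OF x]
    have "related R (f \<cdot> x) (snd R \<cdot> a)"
      by (rule relatedI[OF a eq refl])
    then obtain z where z: "related S x z" "f \<cdot> z = snd R \<cdot> a"
      using ex[of x "snd R \<cdot> a"] x by auto
    obtain h where h: "h \<in> hom C N (rel_obj C S)" "fst S \<cdot> h = x" "snd S \<cdot> h = z"
      by (rule relatedE[OF z(1) S homD(2)[OF x]])
    note [simp] = homD[OF h(1)] h(2,3)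
    have "g \<cdot> h = a"
      by (rule relation_unique[OF R, of _ N]) (use eq z in \<open>simp_all add: hom_def\<close>)
    then show "\<exists>h\<in>hom C N (rel_obj C S). g \<cdot> h = a \<and> fst S \<cdot> h = x"
      using h by auto
  next
    fix N h k assume h: "h \<in> hom C N (rel_obj C S)" and k: "k \<in> hom C N (rel_obj C S)"
      and eq: "g \<cdot> h = g \<cdot> k" "fst S \<cdot> h = fst S \<cdot> k"
    note [simp] = homD[OF h] homD[OF k]
    have "snd R \<cdot> (g \<cdot> h) = snd R \<cdot> (g \<cdot> k)" using eq by simp
    then have "f \<cdot> (snd S \<cdot> h) = f \<cdot> (snd S \<cdot> k)" by simp
    then have "snd S \<cdot> h = snd S \<cdot> k"
      by (rule uniq[OF relatedI[OF h refl refl] relatedI[OF k eq(2)[symmetric] refl]])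
    then show "h = k"
      using relation_unique[OF S h k eq(2)] by simp
  qed (use g f in \<open>simp_all add: hom_def\<close>)
qed

section \<open>Protomodularity\<close>

text \<open>An inverse of the underlying map automatically commutes with the projections and
  sections, so it is again a map of points.\<close>

lemma iso_Pt_iff:
  assumes P: "fst P \<in> hom C A Y" "snd P \<in> hom C Y A" "fst P \<cdot> snd P = Ide C Y"
    and Q: "fst Q \<in> hom C B Y" "snd Q \<in> hom C Y B" "fst Q \<cdot> snd Q = Ide C Y"
    and h: "h \<in> hom C A B" "fst Q \<cdot> h = fst P" "h \<cdot> snd P = snd Q"
  shows "(P, h, Q) \<in> Arr (Pt C Y)" "iso (Pt C Y) (P, h, Q) \<longleftrightarrow> iso C h"
proof -
  have Dom: "Dom C (fst P) = A" "Dom C (fst Q) = B"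
    using homD[OF P(1)] homD[OF Q(1)] by simp_all
  show arr: "(P, h, Q) \<in> Arr (Pt C Y)"
    unfolding Arr_Pt_iff Dom using assms by blast
  then have a: "(P, h, Q) \<in> hom (Pt C Y) P Q"
    by (simp add: hom_def Pt_simps)
  show "iso (Pt C Y) (P, h, Q) \<longleftrightarrow> iso C h"
  proof
    assume "iso (Pt C Y) (P, h, Q)"
    then obtain b where b: "b \<in> hom (Pt C Y) Q P" "b \<cdot>\<^bsub>Pt C Y\<^esub> (P, h, Q) = Ide (Pt C Y) P"
      "(P, h, Q) \<cdot>\<^bsub>Pt C Y\<^esub> b = Ide (Pt C Y) Q"
      by (rule isoD[OF _ a])
    obtain Q' k P' where b_eq: "b = (Q', k, P')"
      by (cases b) auto
    have PQ': "Q' = Q" "P' = P"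
      using homD(2,3)[OF b(1)] by (simp_all add: b_eq Pt_simps)
    have "k \<in> hom C B A"
      using homD(1)[OF b(1)] unfolding b_eq PQ' Arr_Pt_iff Dom by blast
    moreover have "k \<cdot> h = Ide C A" "h \<cdot> k = Ide C B"
      using b(2,3) by (simp_all add: b_eq PQ' Pt_simps Dom)
    ultimately show "iso C h"
      using homD[OF h(1)] unfolding iso_def by blast
  next
    assume "iso C h"
    then obtain k where k: "k \<in> hom C B A" "k \<cdot> h = Ide C A" "h \<cdot> k = Ide C B"
      by (rule isoD[OF _ h(1)])
    note [simp] = homD[OF k(1)] homD[OF h(1)] homD[OF P(1)] homD[OF P(2)] homD[OF Q(1)] homD[OF Q(2)]
    have "fst P \<cdot> k = fst Q"
      using comp_reassoc[OF h(2), of k] k(3) by simp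
    moreover have "k \<cdot> snd Q = snd P"
      using comp_reassoc[OF k(2), of "snd P"] h(3) by simp
    ultimately have "(Q, k, P) \<in> Arr (Pt C Y)"
      unfolding Arr_Pt_iff Dom using P Q k(1) by blast
    then have "(Q, k, P) \<in> hom (Pt C Y) Q P"
      by (simp add: hom_def Pt_simps)
    moreover have "(Q, k, P) \<cdot>\<^bsub>Pt C Y\<^esub> (P, h, Q) = Ide (Pt C Y) P"
      "(P, h, Q) \<cdot>\<^bsub>Pt C Y\<^esub> (Q, k, P) = Ide (Pt C Y) Q"
      using k(2,3) by (simp_all add: Pt_simps)
    ultimately show "iso (Pt C Y) (P, h, Q)"
      using arr unfolding iso_def Pt_simps(1,2) by blast
  qed
qed

section \<open>Base change of points and the reflection of isomorphisms\<close>

lemma base_change_obj_eq: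
  assumes pb: "is_pullback C f v p q" "pb C f v = (p, q)"
    and t: "t \<in> hom C (Dom C v) (Dom C q)" "p \<cdot> t = s \<cdot> v" "q \<cdot> t = Ide C (Dom C v)"
  shows "base_change_obj C v (f, s) = (q, t)"
proof -
  have "(THE t. t \<in> hom C (Dom C v) (Dom C q) \<and> p \<cdot> t = s \<cdot> v \<and> q \<cdot> t = Ide C (Dom C v)) = t"
    by (rule the_equality) (use t pullback_unique[OF pb(1)] in auto)
  then show ?thesis
    by (simp add: base_change_obj_def pb(2))
qed

lemma base_change_arr_eq:
  assumes pb: "pb C f v = (p, q)" "is_pullback C f' v p' q'" "pb C f' v = (p', q')"
    and k: "k \<in> hom C (Dom C q) (Dom C q')" "p' \<cdot> k = h \<cdot> p" "q' \<cdot> k = q"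
  shows "base_change_arr C v ((f, s), h, (f', s')) =
    (base_change_obj C v (f, s), k, base_change_obj C v (f', s'))"
proof -
  have "(THE k. k \<in> hom C (Dom C q) (Dom C q') \<and> p' \<cdot> k = h \<cdot> p \<and> q' \<cdot> k = q) = k"
    by (rule the_equality) (use k pullback_unique[OF pb(2)] in auto)
  then show ?thesis
    by (simp add: base_change_arr_def pb)
qed

text \<open>Protomodularity for arbitrary pullback squares in place of the chosen ones. The two
  given squares share apex and projection \<open>q\<close>, and \<open>h\<close> carries one to the
  other, so the base change of \<open>h\<close> is an identity up to comparison
  isomorphisms.\<close>

lemma protomodular_iso:
  assumes protomodular: "protomodular C"
    and h: "h \<in> hom C A A'" and f': "f' \<in> hom C A' Y" and s: "s \<in> hom C Y A"
    and v: "v \<in> hom C Y' Y"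
    and split: "f' \<cdot> (h \<cdot> s) = Ide C Y"
    and pb: "is_pullback C (f' \<cdot> h) v p q" and pb': "is_pullback C f' v (h \<cdot> p) q"
  shows "iso C h"
proof -
  note [simp] = homD[OF h] homD[OF f'] homD[OF s] homD[OF v] hom_Obj[OF v]
  have f: "f' \<cdot> h \<in> hom C A Y"
    by (simp add: hom_def)
  obtain P Q where PQ: "pb C (f' \<cdot> h) v = (P, Q)" by fastforce
  obtain P' Q' where PQ': "pb C f' v = (P', Q')" by fastforce
  have c: "is_pullback C (f' \<cdot> h) v P Q"
    using pb_is_pullback[OF f v] by (simp add: PQ)
  have c': "is_pullback C f' v P' Q'"
    using pb_is_pullback[OF f' v] by (simp add: PQ')
  have [simp]: "p \<in> Arr C" "q \<in> Arr C" "Dom C p = Dom C q" "Cod C p = A" "Cod C q = Y'"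
    using pullback_square[OF pb] by simp_all
  have [simp]: "P \<in> Arr C" "Q \<in> Arr C" "Dom C P = Dom C Q" "Cod C P = A" "Cod C Q = Y'"
    using pullback_square[OF c] by simp_all
  have [simp]: "P' \<in> Arr C" "Q' \<in> Arr C" "Dom C P' = Dom C Q'" "Cod C P' = A'" "Cod C Q' = Y'"
    using pullback_square[OF c'] by simp_all
  have sq: "f' \<cdot> (h \<cdot> P) = v \<cdot> Q"
    using pullback_square(9)[OF c] by simp
  \<comment> \<open>\<open>k\<close> is the base change of \<open>h\<close> between the chosen
    pullbacks.\<close>
  obtain k where k: "k \<in> hom C (Dom C Q) (Dom C Q')" "P' \<cdot> k = h \<cdot> P" "Q' \<cdot> k = Q"
    by (rule pullback_lift[OF c', of "h \<cdot> P" "Dom C Q" Q]) (use sq in \<open>auto simp: hom_def\<close>)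
  note [simp] = homD[OF k(1)] comp_reassoc[OF k(2)] comp_reassoc[OF k(3)]
  obtain e where e: "e \<in> hom C (Dom C Q) (Dom C q)" "p \<cdot> e = P" "q \<cdot> e = Q"
    by (rule pullback_lift[OF pb, of P "Dom C Q" Q]) (use sq in \<open>auto simp: hom_def\<close>)
  note [simp] = homD[OF e(1)]
  obtain e' where e': "e' \<in> hom C (Dom C Q') (Dom C q)" "(h \<cdot> p) \<cdot> e' = P'" "q \<cdot> e' = Q'"
    by (rule pullback_lift[OF pb', of P' "Dom C Q'" Q'])
      (use pullback_square(9)[OF c'] in \<open>auto simp: hom_def\<close>)
  note [simp] = homD[OF e'(1)]
  have e'_eq: "h \<cdot> (p \<cdot> e') = P'"
    using e'(2) by simp
  \<comment> \<open>The inverse of \<open>k\<close>: pass by \<open>e'\<close> to the shared apex of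
    the given squares, then by \<open>p\<close> and \<open>q\<close> to the chosen pullback of
    \<open>f' \<cdot> h\<close>.\<close>
  obtain l where l: "l \<in> hom C (Dom C Q') (Dom C Q)" "P \<cdot> l = p \<cdot> e'" "Q \<cdot> l = Q'"
  proof (rule pullback_lift[OF c, of "p \<cdot> e'" "Dom C Q'" Q'])
    show "f' \<cdot> h \<cdot> (p \<cdot> e') = v \<cdot> Q'"
      using e'_eq pullback_square(9)[OF c'] by simp
  qed (auto simp: hom_def)
  note [simp] = homD[OF l(1)] comp_reassoc[OF l(2)] comp_reassoc[OF l(3)]
  have obj: "Dom C Q \<in> Obj C" "Dom C Q' \<in> Obj C"
    by auto
  have kl: "k \<cdot> l = Ide C (Dom C Q')"
    by (rule pullback_unique[OF c', of _ "Dom C Q'"]) (use l e'_eq obj in \<open>simp_all add: hom_def\<close>)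
  have ek: "e' \<cdot> k = e"
    by (rule pullback_unique[OF pb', of _ "Dom C Q"])
      (use k e e'_eq comp_reassoc[OF e'_eq, of k] comp_reassoc[OF e'(3), of k] in \<open>simp_all add: hom_def\<close>)
  have lk: "l \<cdot> k = Ide C (Dom C Q)"
    by (rule pullback_unique[OF c, of _ "Dom C Q"]) (use ek k e obj in \<open>simp_all add: hom_def\<close>)
  have "iso C k"
    unfolding iso_def using l(1) kl lk by auto
  obtain t where t: "t \<in> hom C Y' (Dom C Q)" "P \<cdot> t = s \<cdot> v" "Q \<cdot> t = Ide C Y'"
    by (rule pullback_lift[OF c, of "s \<cdot> v" Y' "Ide C Y'"])
      (use comp_reassoc[OF split, of v] in \<open>auto simp: hom_def\<close>)
  note [simp] = homD[OF t(1)]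
  have t': "k \<cdot> t \<in> hom C Y' (Dom C Q')" "P' \<cdot> (k \<cdot> t) = (h \<cdot> s) \<cdot> v" "Q' \<cdot> (k \<cdot> t) = Ide C Y'"
    using t(2,3) by (simp_all add: hom_def)
  have "base_change_arr C v ((f' \<cdot> h, s), h, (f', h \<cdot> s)) = ((Q, t), k, (Q', k \<cdot> t))"
    using base_change_arr_eq[OF PQ c' PQ' k, of s "h \<cdot> s"] base_change_obj_eq[OF c PQ, of t s]
      base_change_obj_eq[OF c' PQ', of "k \<cdot> t" "h \<cdot> s"] t t' by simp
  moreover have "iso (Pt C Y') ((Q, t), k, (Q', k \<cdot> t))"
    using iso_Pt_iff(2)[of "(Q, t)" "Dom C Q" Y' "(Q', k \<cdot> t)" "Dom C Q'" k] t t' k \<open>iso C k\<close>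
    by (simp add: hom_def)
  moreover have P: "((f' \<cdot> h, s), h, (f', h \<cdot> s)) \<in> Arr (Pt C Y)"
    "iso (Pt C Y) ((f' \<cdot> h, s), h, (f', h \<cdot> s)) \<longleftrightarrow> iso C h"
    using iso_Pt_iff[of "(f' \<cdot> h, s)" A Y "(f', h \<cdot> s)" A' h] split by (simp_all add: hom_def)
  moreover have "reflects_isos (Pt C Y) (Pt C Y') (base_change_arr C v)"
    using protomodular homD[OF v] unfolding protomodular_def by metis
  ultimately show "iso C h"
    unfolding reflects_isos_def by metis
qed

text \<open>A split epimorphism's section and the pullback projection \<open>p\<close> are jointly strongly epic:
  the subobject of \<open>A\<close> on which \<open>\<phi>\<close> and \<open>\<psi>\<close> are related contains both, so it is all of \<open>A\<close>.\<close>

lemma protomodular_related: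
  assumes protomodular: "protomodular C"
    and f: "f \<in> hom C A Y" and s: "s \<in> hom C Y A" and split: "f \<cdot> s = Ide C Y"
    and v: "v \<in> hom C Y' Y" and pb: "is_pullback C f v p q"
    and Q: "relation C Z Q" and \<phi>: "\<phi> \<in> hom C A Z" and \<psi>: "\<psi> \<in> hom C A Z"
    and rel_s: "related Q (\<phi> \<cdot> s) (\<psi> \<cdot> s)" and rel_p: "related Q (\<phi> \<cdot> p) (\<psi> \<cdot> p)"
  shows "related Q \<phi> \<psi>"
proof -
  note [simp] = homD[OF f] homD[OF s] homD[OF v] homD[OF \<phi>] homD[OF \<psi>] hom_Obj[OF f] hom_Obj[OF v]
    relation_simps[OF Q]
  define P where "P = Dom C q"
  have [simp]: "p \<in> Arr C" "q \<in> Arr C" "Dom C p = P" "Cod C p = A" "Dom C q = P" "Cod C q = Y'"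
    using pullback_square[OF pb] by (simp_all add: P_def)
  have legs: "fst Q \<in> hom C (rel_obj C Q) Z" "snd Q \<in> hom C (rel_obj C Q) Z"
    by (simp_all add: hom_def)
  \<comment> \<open>\<open>m\<close> is the part of \<open>A\<close> on which \<open>\<phi>\<close>
    and \<open>\<psi>\<close> are related by \<open>Q\<close>.\<close>
  obtain m n where mn: "is_pullback C (pairing C \<phi> \<psi>) (pairing C (fst Q) (snd Q)) m n"
    using pullback_exists[OF pairing(1)[OF \<phi> \<psi>] pairing(1)[OF legs]] by blast
  define M where "M = Dom C n"
  have [simp]: "m \<in> Arr C" "n \<in> Arr C" "Dom C m = M" "Cod C m = A" "Dom C n = M" "Cod C n = rel_obj C Q"
    using pullback_square[OF mn] homD[OF pairing(1)[OF \<phi> \<psi>]] homD[OF pairing(1)[OF legs]]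
    by (simp_all add: M_def)
  have mn_eq: "\<phi> \<cdot> m = fst Q \<cdot> n" "\<psi> \<cdot> m = snd Q \<cdot> n"
    using pairing_comp_eq_iff[OF \<phi> \<psi> legs, of m M n] pullback_square(9)[OF mn]
    by (simp_all add: hom_def)
  have factor: "\<exists>y\<in>hom C N M. m \<cdot> y = x" if x: "x \<in> hom C N A" and rel: "related Q (\<phi> \<cdot> x) (\<psi> \<cdot> x)" for x N
  proof -
    note [simp] = homD[OF x]
    obtain k where k: "k \<in> hom C N (rel_obj C Q)" "fst Q \<cdot> k = \<phi> \<cdot> x" "snd Q \<cdot> k = \<psi> \<cdot> x"
      by (rule relatedE[OF rel Q, of N]) simp_all
    have eq: "pairing C \<phi> \<psi> \<cdot> x = pairing C (fst Q) (snd Q) \<cdot> k"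
      using pairing_comp_eq_iff[OF \<phi> \<psi> legs x k(1)] k by simp
    obtain y where "y \<in> hom C N (Dom C n)" "m \<cdot> y = x"
      by (rule pullback_lift[OF mn _ _ eq])
        (use x k(1) homD[OF pairing(1)[OF \<phi> \<psi>]] homD[OF pairing(1)[OF legs]] in simp_all)
    then show ?thesis
      unfolding M_def by blast
  qed
  have mono: "y = y'"
    if y: "y \<in> hom C N M" and y': "y' \<in> hom C N M" and eq: "m \<cdot> y = m \<cdot> y'" for y y' N
  proof -
    note [simp] = homD[OF y] homD[OF y']
    have "n \<cdot> y = n \<cdot> y'"
      by (rule relation_unique[OF Q, of _ N])
        (use eq comp_reassoc[OF mn_eq(1), of y] comp_reassoc[OF mn_eq(1), of y']
          comp_reassoc[OF mn_eq(2), of y] comp_reassoc[OF mn_eq(2), of y'] in \<open>simp_all add: hom_def\<close>)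
    then show ?thesis
      using eq by (intro pullback_unique[OF mn, of y N y']) (simp_all add: hom_def)
  qed
  obtain s' where s': "s' \<in> hom C Y M" "m \<cdot> s' = s"
    using factor[OF s rel_s] by blast
  have "p \<in> hom C P A"
    by (simp add: hom_def)
  from factor[OF this rel_p] obtain p' where p': "p' \<in> hom C P M" "m \<cdot> p' = p"
    by blast
  note [simp] = homD[OF s'(1)] homD[OF p'(1)] comp_reassoc[OF p'(2)] comp_reassoc[OF pullback_square(9)[OF pb]]
  \<comment> \<open>The pullback of \<open>f\<close> along \<open>v\<close> factors through
    \<open>m\<close> by \<open>p'\<close>. As \<open>m\<close> is monic, the same apex is then also
    the pullback of \<open>f \<cdot> m\<close>, so \<open>m\<close> becomes invertible after base
    change.\<close>
  have "iso C m"
  proof (rule protomodular_iso[OF protomodular _ f s'(1) v])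
    show "m \<in> hom C M A" by (simp add: hom_def)
    show "f \<cdot> (m \<cdot> s') = Ide C Y"
      using s' split by simp
    show "is_pullback C f v (m \<cdot> p') q"
      using pb p'(2) by simp
    show "is_pullback C (f \<cdot> m) v p' q"
    proof (rule is_pullbackI[of _ M Y _ Y' _ P])
      show "(f \<cdot> m) \<cdot> p' = v \<cdot> q"
        using pullback_square(9)[OF pb] p'(2) by simp
    next
      fix N x y assume x: "x \<in> hom C N M" and y: "y \<in> hom C N Y'" and eq: "(f \<cdot> m) \<cdot> x = v \<cdot> y"
      note [simp] = homD[OF x] homD[OF y]
      obtain z where z: "z \<in> hom C N (Dom C q)" "p \<cdot> z = m \<cdot> x" "q \<cdot> z = y"
        by (rule pullback_lift[OF pb, of "m \<cdot> x" N y]) (use eq in \<open>simp_all add: hom_def\<close>)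
      note [simp] = homD[OF z(1)]
      have "p' \<cdot> z = x"
        by (rule mono[of _ N]) (use z in \<open>simp_all add: hom_def\<close>)
      then show "\<exists>h\<in>hom C N P. p' \<cdot> h = x \<and> q \<cdot> h = y"
        using z by auto
    next
      fix N x y assume x: "x \<in> hom C N P" and y: "y \<in> hom C N P"
        and eq: "p' \<cdot> x = p' \<cdot> y" "q \<cdot> x = q \<cdot> y"
      note [simp] = homD[OF x] homD[OF y]
      have "m \<cdot> (p' \<cdot> x) = m \<cdot> (p' \<cdot> y)" using eq by simp
      then have "p \<cdot> x = p \<cdot> y" by simp
      then show "x = y"
        using eq by (intro pullback_unique[OF pb, of x N y]) (simp_all add: hom_def)
    qed (use p'(1) v in \<open>simp_all add: hom_def\<close>)
  qed
  then obtain j where j: "j \<in> hom C A M" "m \<cdot> j = Ide C A"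
    by (rule isoD[of C m M A]) (simp add: hom_def)
  note [simp] = homD[OF j(1)]
  show ?thesis
    by (rule relatedI[of "n \<cdot> j" A])
      (use j comp_reassoc[OF mn_eq(1), of j] comp_reassoc[OF mn_eq(2), of j] in \<open>simp_all add: hom_def\<close>)
qed

section \<open>Centralization\<close>

text \<open>Saturation says that \<open>U\<close> is closed under \<open>T\<close>: what is related
  to an element of \<open>U\<close> lies in \<open>U\<close>. Uniqueness of the lift comes from
  \<open>u\<close> being monic.\<close>

lemma saturatedI:
  assumes u: "u \<in> hom C U X" "monic C u" and T: "relation C X T"
    and sat: "\<And>N x y. x \<in> hom C N U \<Longrightarrow> related T (u \<cdot> x) y \<Longrightarrow> \<exists>z\<in>hom C N U. u \<cdot> z = y"
  shows "saturated C u T"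
proof -
  note I = relation_inverse_image[OF T u(1)]
  note iff = related_inverse_image_iff[OF T u(1)]
  note [simp] = relation_simps[OF T] relation_simps[OF I] homD[OF u(1)]
  let ?I = "inverse_image C u T"
  have "related T (u \<cdot> fst ?I) (u \<cdot> snd ?I)"
    using iff[of "fst ?I" "rel_obj C ?I" "snd ?I"] related_legs[OF I] by (simp add: hom_def)
  then obtain g where g: "g \<in> hom C (rel_obj C ?I) (rel_obj C T)"
    "fst T \<cdot> g = u \<cdot> fst ?I" "snd T \<cdot> g = u \<cdot> snd ?I"
    by (rule relatedE[OF _ T, of _ _ "rel_obj C ?I"]) simp_all
  have "fibrant C ?I T u g"
  proof (rule fibrantI[OF I T u(1) g])
    fix x y assume x: "x \<in> hom C (Dom C x) U" and xy: "related T (u \<cdot> x) y"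
    then obtain z where z: "z \<in> hom C (Dom C x) U" "u \<cdot> z = y"
      using sat by blast
    then show "\<exists>z. related ?I x z \<and> u \<cdot> z = y"
      using iff[OF x z(1)] xy by blast
  next
    fix x z z' assume xz: "related ?I x z" "related ?I x z'" and eq: "u \<cdot> z = u \<cdot> z'"
    have "z \<in> hom C (Dom C x) U" "z' \<in> hom C (Dom C x) U"
      using relatedE[OF xz(1) I refl] relatedE[OF xz(2) I refl] by blast+
    then show "z = z'"
      using monicD[OF u(2), of z "Dom C x" z'] eq by simp
  qed
  then show ?thesis
    by (auto simp: saturated_def)
qed

text \<open>\<open>centralize\<close> quantifies existentially over its own reflexivity map; this
  identifies that map with the fixed \<open>s\<close>.\<close>

lemma reflexivity_unique:
  assumes R: "relation C X R" and s: "is_reflexivity C X R s" "is_reflexivity C X R s'"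
  shows "s = s'"
  by (rule relation_unique[OF R, of _ X]) (use s in \<open>simp_all add: is_reflexivity_def\<close>)

text \<open>Of the double relation only its vertical part \<open>V\<close> on \<open>R\<close> is
  kept. The reflexivity \<open>z\<close> of the other part carries \<open>S\<close> into
  \<open>V\<close> along \<open>s\<close>, and fibrancy of the first leg gives saturation.\<close>

lemma centralizeE:
  assumes R: "equivalence C X R" and S: "equivalence C X S" and s: "is_reflexivity C X R s"
    and "centralize C X R S"
  obtains V where "equivalence C (rel_obj C R) V" "saturated C s V"
    "\<And>x y. related S x y \<Longrightarrow> related V (s \<cdot> x) (s \<cdot> y)"
proof -
  note rR = equivalence_relation[OF R] and rS = equivalence_relation[OF S]
  obtain V H z where obj: "rel_obj C V = rel_obj C H"
    and V: "equivalence C (rel_obj C R) V" and H: "equivalence C (rel_obj C S) H"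
    and z: "is_reflexivity C (rel_obj C S) H z"
    and mor: "equ_morphism C S V s z" and fib: "fibrant C V S (fst R) (fst H)"
    using assms(4) reflexivity_unique[OF rR s] unfolding centralize_def by blast
  note rV = equivalence_relation[OF V] and rH = equivalence_relation[OF H]
  have s': "s \<in> hom C X (rel_obj C R)" "fst R \<cdot> s = Ide C X"
    using s by (auto simp: is_reflexivity_def)
  have z': "z \<in> hom C (rel_obj C S) (rel_obj C V)" "fst H \<cdot> z = Ide C (rel_obj C S)"
    "fst V \<cdot> z = s \<cdot> fst S" "snd V \<cdot> z = s \<cdot> snd S"
    using z mor by (auto simp: is_reflexivity_def equ_morphism_def)
  have pb: "is_pullback C (fst S) (fst R) (fst H) (fst V)"
    and fst_H: "fst S \<cdot> fst H = fst R \<cdot> fst V"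
    using fib by (auto simp: fibrant_def equ_morphism_def)
  note [simp] = relation_simps[OF rR] relation_simps[OF rS] relation_simps[OF rV] relation_simps[OF rH]
    homD[OF s'(1)] homD[OF z'(1)] obj[symmetric]
    comp_reassoc[OF s'(2)] comp_reassoc[OF z'(2)] comp_reassoc[OF z'(3)] comp_reassoc[OF z'(4)]
    comp_reassoc[OF fst_H]
  show ?thesis
  proof (rule that[OF V])
    fix x y assume "related S x y"
    then obtain h where h: "h \<in> hom C (Dom C x) (rel_obj C S)" "fst S \<cdot> h = x" "snd S \<cdot> h = y"
      by (rule relatedE[OF _ rS refl])
    note [simp] = homD[OF h(1)]
    show "related V (s \<cdot> x) (s \<cdot> y)"
      by (rule relatedI[of "z \<cdot> h" "Dom C x"]) (simp_all add: hom_def h)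
  next
    show "saturated C s V"
    proof (rule saturatedI[OF s'(1) _ rV])
      show "monic C s"
      proof (rule monicI[OF s'(1)])
        fix N h k assume h: "h \<in> hom C N X" and k: "k \<in> hom C N X" and "s \<cdot> h = s \<cdot> k"
        then have "fst R \<cdot> (s \<cdot> h) = fst R \<cdot> (s \<cdot> k)" by simp
        then show "h = k"
          using homD[OF h] homD[OF k] by simp
      qed
      fix N x y assume x: "x \<in> hom C N X" and "related V (s \<cdot> x) y"
      note [simp] = homD[OF x]
      obtain h where h: "h \<in> hom C N (rel_obj C V)" "fst V \<cdot> h = s \<cdot> x" "snd V \<cdot> h = y"
        by (rule relatedE[OF \<open>related V (s \<cdot> x) y\<close> rV, of N]) simp_all
      note [simp] = homD[OF h(1)]
      \<comment> \<open>Both sides start at \<open>s \<cdot> x\<close> and have the same image under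
        \<open>fst H\<close>, hence agree in the pullback. So \<open>h\<close> is a value of
        \<open>z\<close>, and its endpoint lies in the image of \<open>s\<close>.\<close>
      have eq: "h = z \<cdot> (fst H \<cdot> h)"
        by (rule pullback_unique[OF pb, of _ N]) (use h(2) in \<open>simp_all add: hom_def\<close>)
      have "y = s \<cdot> (snd S \<cdot> (fst H \<cdot> h))"
        using arg_cong[OF eq, of "\<lambda>h. snd V \<cdot> h"] h(3) by simp
      then show "\<exists>z\<in>hom C N X. s \<cdot> z = y"
        by (intro bexI[of _ "snd S \<cdot> (fst H \<cdot> h)"]) (simp_all add: hom_def)
    qed
  qed
qed

text \<open>The relation \<nabla> on \<open>X\<close> contains every relation on \<open>X\<close>,
  so using it in the saturating property selects the largest relation for which \<open>s\<close> is
  saturated.\<close>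

lemma indiscrete_equivalence:
  assumes X: "X \<in> Obj C"
  defines "D \<equiv> (pr0 C X X, pr1 C X X)"
  shows "equivalence C X D" "x \<in> hom C N X \<Longrightarrow> y \<in> hom C N X \<Longrightarrow> related D x y"
proof -
  note [simp] = X
  have legs: "pr0 C X X \<in> hom C (Dom C (pr0 C X X)) X" "pr1 C X X \<in> hom C (Dom C (pr0 C X X)) X"
    by (simp_all add: hom_def)
  have rel: "relation C X D" "rel_obj C D = Dom C (pr0 C X X)"
    using relationI[OF legs product_unique[OF X X]] by (simp_all add: D_def)
  show all: "related D x y" if "x \<in> hom C N X" "y \<in> hom C N X" for x y N
    by (rule relatedI[of "pairing C x y" N]) (use pairing[OF that] rel(2) in \<open>simp_all add: D_def\<close>)
  show "equivalence C X D"
  proof (rule equivalenceI[OF rel(1) all[OF Ide_hom Ide_hom]])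
    fix x y z assume "related D x y" "related D x z"
    then show "related D y z"
      using all relatedE[OF _ rel(1) refl] by metis
  qed simp_all
qed

end

section \<open>An equivalence relation \<open>T\<close> on \<open>R\<close> for which the
  reflexivity map \<open>s\<close> is saturated\<close>

locale saturated_relation = finitely_complete_category C for C :: "('o, 'm) cat" (structure) +
  fixes X :: 'o and R T :: "'m \<times> 'm" and s r g :: 'm
  assumes protomodular: "protomodular C"
    and R: "equivalence C X R" and s: "is_reflexivity C X R s"
    and T: "equivalence C (rel_obj C R) T" and r: "is_reflexivity C (rel_obj C R) T r"
    and fibrant: "fibrant C (inverse_image C s T) T s g"
begin

abbreviation (input) "S \<equiv> inverse_image C s T"

lemma s': "s \<in> hom C X (rel_obj C R)" "fst R \<cdot> s = Ide C X" "snd R \<cdot> s = Ide C X"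
  using s by (auto simp: is_reflexivity_def)

lemma r': "r \<in> hom C (rel_obj C R) (rel_obj C T)"
  "fst T \<cdot> r = Ide C (rel_obj C R)" "snd T \<cdot> r = Ide C (rel_obj C R)"
  using r by (auto simp: is_reflexivity_def)

lemma S: "equivalence C X S"
  by (rule equivalence_inverse_image[OF T s'(1)])

lemmas relations = equivalence_relation[OF R] equivalence_relation[OF T] equivalence_relation[OF S]

lemma g: "g \<in> hom C (rel_obj C S) (rel_obj C T)" "fst T \<cdot> g = s \<cdot> fst S" "snd T \<cdot> g = s \<cdot> snd S"
  "is_pullback C (fst T) s g (fst S)"
  using fibrant by (auto simp: fibrant_def equ_morphism_def)

lemmas hom_simps [simp] = relation_simps[OF relations(1)] relation_simps[OF relations(2)]
  relation_simps[OF relations(3)] homD[OF s'(1)] homD[OF r'(1)] homD[OF g(1)]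

lemmas comp_eqs [simp] = s'(2,3) r'(2,3) g(2,3) s'(2,3)[THEN comp_reassoc] r'(2,3)[THEN comp_reassoc]
  g(2,3)[THEN comp_reassoc]

text \<open>For any retraction \<open>e\<close> of \<open>s\<close>, by joint strong epicity of
  \<open>r\<close> and \<open>g\<close>: on \<open>r\<close> both sides become \<open>e\<close>,
  where reflexivity applies, and on \<open>g\<close> they become the legs of
  \<open>S\<close>.\<close>

lemma related_S:
  assumes e: "e \<in> hom C (rel_obj C R) X" and es: "e \<cdot> s = Ide C X"
  shows "related S (e \<cdot> fst T) (e \<cdot> snd T)"
proof -
  note [simp] = homD[OF e] comp_reassoc[OF es]
  show ?thesis
  proof (rule protomodular_related[OF protomodular _ r'(1) _ s'(1) g(4) relations(3)])
    show "related S ((e \<cdot> fst T) \<cdot> r) ((e \<cdot> snd T) \<cdot> r)"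
      using related_refl[OF S e] by simp
    show "related S ((e \<cdot> fst T) \<cdot> g) ((e \<cdot> snd T) \<cdot> g)"
      using related_legs[OF relations(3)] by simp
  qed (simp_all add: hom_def)
qed

end

section \<open>The relation \<open>(p0, p1)\<close> on \<open>S\<close> induced by the two legs of
  \<open>R\<close>\<close>

locale double_relation = saturated_relation C X R T s r g
  for C :: "('o, 'm) cat" (structure) and X R T s r g +
  fixes p0 p1 :: 'm
  assumes p0: "p0 \<in> hom C (rel_obj C T) (rel_obj C S)"
      "fst S \<cdot> p0 = fst R \<cdot> fst T" "snd S \<cdot> p0 = fst R \<cdot> snd T"
    and p1: "p1 \<in> hom C (rel_obj C T) (rel_obj C S)"
      "fst S \<cdot> p1 = snd R \<cdot> fst T" "snd S \<cdot> p1 = snd R \<cdot> snd T"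
begin

lemmas p_simps [simp] = homD[OF p0(1)] homD[OF p1(1)] p0(2,3) p1(2,3)
  p0(2,3)[THEN comp_reassoc] p1(2,3)[THEN comp_reassoc]

text \<open>Since \<open>fst R\<close> retracts \<open>s\<close>, a pair of the form
  \<open>s \<cdot> x\<close>, \<open>s \<cdot> y\<close> is sent back to \<open>x\<close>,
  \<open>y\<close>. With the same fact for \<open>p1\<close>, this makes \<open>g\<close> the
  reflexivity map of \<open>(p0, p1)\<close>.\<close>

lemma p0_g [simp]: "p0 \<cdot> g = Ide C (rel_obj C S)"
  by (rule relation_unique[OF relations(3), of _ "rel_obj C S"]) (simp_all add: hom_def)

lemma p1_g [simp]: "p1 \<cdot> g = Ide C (rel_obj C S)"
  by (rule relation_unique[OF relations(3), of _ "rel_obj C S"]) (simp_all add: hom_def)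

lemmas p_g [simp] = comp_reassoc[OF p0_g] comp_reassoc[OF p1_g]

text \<open>\<open>T\<close> is compared with the pullback of \<open>S\<close> along
  \<open>fst R\<close>. Both are split over \<open>R\<close>, and both restrict along
  \<open>s\<close> to \<open>S\<close>, so by protomodularity the comparison \<open>h\<close> is
  invertible.\<close>

lemma fibrant_p0: "fibrant C T S (fst R) p0"
proof -
  obtain a b where ab: "is_pullback C (fst S) (fst R) a b"
    using pullback_exists[of "fst S" "rel_obj C S" X "fst R" "rel_obj C R"] by (auto simp: hom_def)
  define B where "B = Dom C b"
  have [simp]: "a \<in> Arr C" "b \<in> Arr C" "Dom C a = B" "Dom C b = B" "Cod C a = rel_obj C S" "Cod C b = rel_obj C R"
    using pullback_square[OF ab] by (simp_all add: B_def)
  note [simp] = comp_reassoc[OF pullback_square(9)[OF ab]]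
  obtain h where h: "h \<in> hom C (rel_obj C T) (Dom C b)" "a \<cdot> h = p0" "b \<cdot> h = fst T"
    by (rule pullback_lift[OF ab, of p0 "rel_obj C T" "fst T"]) (simp_all add: hom_def)
  note [simp] = homD[OF h(1)] comp_reassoc[OF h(2)] comp_reassoc[OF h(3)]
  have "iso C h"
  proof (rule protomodular_iso[OF protomodular h(1) _ r'(1) s'(1)])
    show "is_pullback C (b \<cdot> h) s g (fst S)"
      using g(4) h(3) by simp
    \<comment> \<open>Over \<open>s \<cdot> y\<close> an element \<open>x\<close> of the pullback is
      determined by \<open>a \<cdot> x\<close>, whose first leg is \<open>y\<close>.\<close>
    show "is_pullback C b s (h \<cdot> g) (fst S)"
    proof (rule is_pullbackI[of b B "rel_obj C R" s X _ "rel_obj C S"])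
      fix N x y assume x: "x \<in> hom C N B" and y: "y \<in> hom C N X" and eq: "b \<cdot> x = s \<cdot> y"
      note [simp] = homD[OF x] homD[OF y]
      have y': "fst S \<cdot> (a \<cdot> x) = y"
        using eq by simp
      have "(h \<cdot> g) \<cdot> (a \<cdot> x) = x"
        by (rule pullback_unique[OF ab, of _ N]) (use y' eq in \<open>simp_all add: hom_def\<close>)
      then show "\<exists>k\<in>hom C N (rel_obj C S). (h \<cdot> g) \<cdot> k = x \<and> fst S \<cdot> k = y"
        using y' by (intro bexI[of _ "a \<cdot> x"] conjI) (simp_all add: hom_def)
    next
      fix N k l assume k: "k \<in> hom C N (rel_obj C S)" and l: "l \<in> hom C N (rel_obj C S)"
        and eq: "(h \<cdot> g) \<cdot> k = (h \<cdot> g) \<cdot> l"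
      note [simp] = homD[OF k] homD[OF l]
      have "a \<cdot> ((h \<cdot> g) \<cdot> k) = a \<cdot> ((h \<cdot> g) \<cdot> l)"
        using eq by (rule arg_cong)
      then show "k = l" by simp
    qed (simp_all add: hom_def)
  qed (simp_all add: hom_def)
  from pullback_iso[OF ab this h(1)] have "is_pullback C (fst S) (fst R) p0 (fst T)"
    using h by simp
  then show ?thesis
    by (simp add: fibrant_def equ_morphism_def hom_def)
qed

text \<open>An element of \<open>T\<close> is a square in \<open>X\<close>, with two sides in
  \<open>R\<close> and two in \<open>S\<close>. The sides \<open>p0\<close> and \<open>p1\<close>
  contain all four corners, and the corners determine the square by joint monicity for
  \<open>R\<close> and then for \<open>T\<close>.\<close>

lemma relation_H: "relation C (rel_obj C S) (p0, p1)" "rel_obj C (p0, p1) = rel_obj C T"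
proof -
  have mono: "h = k"
    if h: "h \<in> hom C N (rel_obj C T)" and k: "k \<in> hom C N (rel_obj C T)"
      and eq: "p0 \<cdot> h = p0 \<cdot> k" "p1 \<cdot> h = p1 \<cdot> k" for h k N
  proof -
    note [simp] = homD[OF h] homD[OF k]
    have "fst S \<cdot> (p0 \<cdot> h) = fst S \<cdot> (p0 \<cdot> k)" "snd S \<cdot> (p0 \<cdot> h) = snd S \<cdot> (p0 \<cdot> k)"
      "fst S \<cdot> (p1 \<cdot> h) = fst S \<cdot> (p1 \<cdot> k)" "snd S \<cdot> (p1 \<cdot> h) = snd S \<cdot> (p1 \<cdot> k)"
      by (simp_all only: eq)
    then have eqs: "fst R \<cdot> (fst T \<cdot> h) = fst R \<cdot> (fst T \<cdot> k)" "fst R \<cdot> (snd T \<cdot> h) = fst R \<cdot> (snd T \<cdot> k)"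
      "snd R \<cdot> (fst T \<cdot> h) = snd R \<cdot> (fst T \<cdot> k)" "snd R \<cdot> (snd T \<cdot> h) = snd R \<cdot> (snd T \<cdot> k)"
      by simp_all
    have "fst T \<cdot> h = fst T \<cdot> k" "snd T \<cdot> h = snd T \<cdot> k"
      by (rule relation_unique[OF relations(1), of _ N]; use eqs in \<open>simp add: hom_def\<close>)+
    then show "h = k"
      by (rule relation_unique[OF relations(2) h k])
  qed
  show "relation C (rel_obj C S) (p0, p1)" "rel_obj C (p0, p1) = rel_obj C T"
    using relationI[OF p0(1) p1(1) mono] by simp_all
qed

text \<open>On the kernel pair of \<open>d\<^sub>0 : R \<rightarrow> X\<close>, the division \<open>\<delta>\<close> sends \<open>(x R y, x R z)\<close> to \<open>y R z\<close>;
  protomodularity shows that it preserves \<open>T\<close>.\<close>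

lemma euclidean_H:
  assumes "related (p0, p1) a b" "related (p0, p1) a c"
  shows "related (p0, p1) b c"
proof -
  obtain h where h: "h \<in> hom C (Dom C a) (rel_obj C T)" "p0 \<cdot> h = a" "p1 \<cdot> h = b"
    by (rule relatedE[OF assms(1) relation_H(1) refl]) (simp add: relation_H(2))
  obtain k where k: "k \<in> hom C (Dom C a) (rel_obj C T)" "p0 \<cdot> k = a" "p1 \<cdot> k = c"
    by (rule relatedE[OF assms(2) relation_H(1) refl]) (simp add: relation_H(2))
  define N where "N = Dom C a"
  note [simp] = homD[OF h(1)[folded N_def]] homD[OF k(1)[folded N_def]]
  \<comment> \<open>The generic pair of squares in \<open>T\<close> with a common side under
    \<open>p0\<close>.\<close>
  obtain v w where vw: "is_pullback C p0 p0 v w"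
    using pullback_exists[OF p0(1) p0(1)] by blast
  define W where "W = Dom C w"
  have [simp]: "v \<in> Arr C" "w \<in> Arr C" "Dom C v = W" "Dom C w = W" "Cod C v = rel_obj C T" "Cod C w = rel_obj C T"
    using pullback_square[OF vw] by (simp_all add: W_def)
  have vw_eq: "p0 \<cdot> v = p0 \<cdot> w"
    by (rule pullback_square(9)[OF vw])
  have vw_R: "fst R \<cdot> (fst T \<cdot> v) = fst R \<cdot> (fst T \<cdot> w)" "fst R \<cdot> (snd T \<cdot> v) = fst R \<cdot> (snd T \<cdot> w)"
    using arg_cong[OF vw_eq, of "\<lambda>x. fst S \<cdot> x"] arg_cong[OF vw_eq, of "\<lambda>x. snd S \<cdot> x"] by simp_all
  \<comment> \<open>The kernel pair \<open>D\<close> of \<open>fst R\<close>. Below,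
    \<open>f\<close> and \<open>f'\<close> send a pair of squares in \<open>W\<close> to the pair of
    their first, respectively second, sides in \<open>R\<close>.\<close>
  obtain q q' where qq': "is_pullback C (fst R) (fst R) q q'"
    using pullback_exists[of "fst R" "rel_obj C R" X "fst R" "rel_obj C R"] by (auto simp: hom_def)
  define D where "D = Dom C q'"
  have [simp]: "q \<in> Arr C" "q' \<in> Arr C" "Dom C q = D" "Dom C q' = D" "Cod C q = rel_obj C R" "Cod C q' = rel_obj C R"
    using pullback_square[OF qq'] by (simp_all add: D_def)
  have qq'_eq: "fst R \<cdot> q = fst R \<cdot> q'"
    by (rule pullback_square(9)[OF qq'])
  have [simp]: "D \<in> Obj C"
    using Obj_Dom[of q] by simp
  obtain f where f: "f \<in> hom C W (Dom C q')" "q \<cdot> f = fst T \<cdot> v" "q' \<cdot> f = fst T \<cdot> w"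
    by (rule pullback_lift[OF qq', of "fst T \<cdot> v" W "fst T \<cdot> w"]) (use vw_R in \<open>simp_all add: hom_def\<close>)
  obtain f' where f': "f' \<in> hom C W (Dom C q')" "q \<cdot> f' = snd T \<cdot> v" "q' \<cdot> f' = snd T \<cdot> w"
    by (rule pullback_lift[OF qq', of "snd T \<cdot> v" W "snd T \<cdot> w"]) (use vw_R in \<open>simp_all add: hom_def\<close>)
  note [simp] = homD[OF f(1)] homD[OF f'(1)] f(2,3)[THEN comp_reassoc] f'(2,3)[THEN comp_reassoc]
  \<comment> \<open>Pairs of degenerate squares give a common section \<open>t\<close> of
    \<open>f\<close> and \<open>f'\<close>.\<close>
  have "p0 \<cdot> (r \<cdot> q) = p0 \<cdot> (r \<cdot> q')"
    by (rule relation_unique[OF relations(3), of _ D]) (use qq'_eq in \<open>simp_all add: hom_def\<close>)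
  then obtain t where t: "t \<in> hom C D (Dom C w)" "v \<cdot> t = r \<cdot> q" "w \<cdot> t = r \<cdot> q'"
    by (rule pullback_lift[OF vw, of "r \<cdot> q" D "r \<cdot> q'", rotated 2]) (simp_all add: hom_def)
  note [simp] = homD[OF t(1)] t(2,3) t(2,3)[THEN comp_reassoc]
  have ft [simp]: "f \<cdot> t = Ide C D" "f' \<cdot> t = Ide C D"
    by (rule pullback_unique[OF qq', of _ D]; simp add: hom_def)+
  \<comment> \<open>The diagonals of \<open>s\<close> and, next, of \<open>g\<close>: they take the
    place of \<open>s\<close> and \<open>g\<close> over the kernel pair.\<close>
  obtain \<sigma> where \<sigma>: "\<sigma> \<in> hom C X (Dom C q')" "q \<cdot> \<sigma> = s" "q' \<cdot> \<sigma> = s"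
    by (rule pullback_lift[OF qq', of s X s]) (simp_all add: hom_def)
  note [simp] = homD[OF \<sigma>(1)] \<sigma>(2,3) \<sigma>(2,3)[THEN comp_reassoc]
  obtain p where p: "p \<in> hom C (rel_obj C S) (Dom C w)" "v \<cdot> p = g" "w \<cdot> p = g"
    by (rule pullback_lift[OF vw, of g "rel_obj C S" g]) (simp_all add: hom_def)
  note [simp] = homD[OF p(1)] p(2,3) p(2,3)[THEN comp_reassoc]
  have fp: "f \<cdot> p = \<sigma> \<cdot> fst S" "f' \<cdot> p = \<sigma> \<cdot> snd S"
    by (rule pullback_unique[OF qq', of _ "rel_obj C S"]; simp add: hom_def)+
  note [simp] = fp fp[THEN comp_reassoc]
  \<comment> \<open>If both first sides equal \<open>s \<cdot> y\<close>, saturation writes both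
    squares as values of \<open>g\<close>. Their common image under \<open>p0\<close> makes the two
    arguments equal, because \<open>p0 \<cdot> g\<close> is an identity.\<close>
  have pb: "is_pullback C f \<sigma> p (fst S)"
  proof (rule is_pullbackI[of f W D \<sigma> X _ "rel_obj C S"])
    fix M x y assume x: "x \<in> hom C M W" and y: "y \<in> hom C M X" and eq: "f \<cdot> x = \<sigma> \<cdot> y"
    note [simp] = homD[OF x] homD[OF y]
    have eqs: "fst T \<cdot> (v \<cdot> x) = s \<cdot> y" "fst T \<cdot> (w \<cdot> x) = s \<cdot> y"
      using arg_cong[OF eq, of "\<lambda>x. q \<cdot> x"] arg_cong[OF eq, of "\<lambda>x. q' \<cdot> x"] by simp_all
    obtain l where l: "l \<in> hom C M (Dom C (fst S))" "g \<cdot> l = v \<cdot> x" "fst S \<cdot> l = y"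
      by (rule pullback_lift[OF g(4), of "v \<cdot> x" M y]) (use eqs in \<open>simp_all add: hom_def\<close>)
    obtain l' where l': "l' \<in> hom C M (Dom C (fst S))" "g \<cdot> l' = w \<cdot> x" "fst S \<cdot> l' = y"
      by (rule pullback_lift[OF g(4), of "w \<cdot> x" M y]) (use eqs in \<open>simp_all add: hom_def\<close>)
    note [simp] = homD[OF l(1)] homD[OF l'(1)]
    have "l = l'"
      using arg_cong[OF l(2), of "\<lambda>x. p0 \<cdot> x"] arg_cong[OF l'(2), of "\<lambda>x. p0 \<cdot> x"]
        comp_reassoc[OF vw_eq, of x] by simp
    then have "p \<cdot> l = x"
      by (intro pullback_unique[OF vw, of "p \<cdot> l" M x]) (use l(2) l'(2) in \<open>simp_all add: hom_def\<close>)
    then show "\<exists>l\<in>hom C M (rel_obj C S). p \<cdot> l = x \<and> fst S \<cdot> l = y"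
      using l by auto
  next
    fix M l l' assume l: "l \<in> hom C M (rel_obj C S)" and l': "l' \<in> hom C M (rel_obj C S)"
      and eq: "p \<cdot> l = p \<cdot> l'"
    note [simp] = homD[OF l] homD[OF l']
    have "p0 \<cdot> (v \<cdot> (p \<cdot> l)) = p0 \<cdot> (v \<cdot> (p \<cdot> l'))"
      by (simp only: eq)
    then show "l = l'" by simp
  qed (simp_all add: hom_def)
  have "related R (fst R \<cdot> q) (snd R \<cdot> q)" "related R (fst R \<cdot> q') (snd R \<cdot> q')"
    by (rule relatedI[of q D] relatedI[of q' D]; simp add: hom_def)+
  then have "related R (snd R \<cdot> q) (snd R \<cdot> q')"
    unfolding qq'_eq using related_sym[OF R] related_trans[OF R] by blast
  then obtain \<delta> where \<delta>: "\<delta> \<in> hom C D (rel_obj C R)" "fst R \<cdot> \<delta> = snd R \<cdot> q" "snd R \<cdot> \<delta> = snd R \<cdot> q'"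
    by (rule relatedE[OF _ relations(1), of _ _ D]) simp_all
  note [simp] = homD[OF \<delta>(1)] \<delta>(2,3)[THEN comp_reassoc]
  have \<delta>\<sigma>: "\<delta> \<cdot> \<sigma> = s"
    by (rule relation_unique[OF relations(1), of _ X]) (simp_all add: hom_def)
  note [simp] = comp_reassoc[OF \<delta>\<sigma>]
  \<comment> \<open>On \<open>t\<close> both sides reduce to \<delta>. On \<open>p\<close> they
    reduce to \<open>s\<close> composed with the legs of \<open>S\<close>, because \<delta> sends
    the diagonal of \<open>s\<close> to \<open>s\<close>.\<close>
  have "related T (\<delta> \<cdot> f) (\<delta> \<cdot> f')"
  proof (rule protomodular_related[OF protomodular _ _ _ _ pb relations(2)])
    show "related T ((\<delta> \<cdot> f) \<cdot> t) ((\<delta> \<cdot> f') \<cdot> t)"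
      using related_refl[OF T \<delta>(1)] by simp
    show "related T ((\<delta> \<cdot> f) \<cdot> p) ((\<delta> \<cdot> f') \<cdot> p)"
      by (rule relatedI[OF g(1)]) simp_all
    show "f \<in> hom C W D" "t \<in> hom C D W" "\<sigma> \<in> hom C X D" "f \<cdot> t = Ide C D"
      "\<delta> \<cdot> f \<in> hom C W (rel_obj C R)" "\<delta> \<cdot> f' \<in> hom C W (rel_obj C R)"
      by (simp_all add: hom_def)
  qed
  then obtain m where m: "m \<in> hom C W (rel_obj C T)" "fst T \<cdot> m = \<delta> \<cdot> f" "snd T \<cdot> m = \<delta> \<cdot> f'"
    by (rule relatedE[OF _ relations(2), of _ _ W]) simp_all
  note [simp] = homD[OF m(1)] m(2,3) f(2,3) f'(2,3)
  \<comment> \<open>The divided square \<open>m\<close> has as its sides the \<open>p1\<close>-sides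
    of the two given squares, which is exactly the Euclidean law.\<close>
  have pm: "p0 \<cdot> m = p1 \<cdot> v" "p1 \<cdot> m = p1 \<cdot> w"
    by (rule relation_unique[OF relations(3), of _ W]; simp add: hom_def)+
  obtain l where l: "l \<in> hom C N (Dom C w)" "v \<cdot> l = h" "w \<cdot> l = k"
    by (rule pullback_lift[OF vw, of h N k]) (use h(2) k(2) in \<open>simp_all add: hom_def\<close>)
  note [simp] = homD[OF l(1)] l(2,3) pm[THEN comp_reassoc]
  show ?thesis
    by (rule relatedI[of "m \<cdot> l" N]) (use h(3) k(3) in \<open>simp_all add: hom_def relation_H(2)\<close>)
qed

text \<open>The double relation is \<open>T\<close> itself, with legs to \<open>R\<close> from
  \<open>T\<close>, legs to \<open>S\<close> given by \<open>(p0, p1)\<close>, and \<open>g\<close>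
  as the reflexivity map from \<open>S\<close>.\<close>

lemma centralize: "centralize C X R S"
  unfolding centralize_def
proof (intro exI conjI)
  let ?H = "(p0, p1)"
  show "rel_obj C T = rel_obj C ?H"
    by (simp add: relation_H(2))
  show "equivalence C (rel_obj C R) T" by (rule T)
  show z: "is_reflexivity C (rel_obj C S) ?H g"
    using g(1) by (simp add: is_reflexivity_def relation_H(2))
  show "equivalence C (rel_obj C S) ?H"
  proof (rule equivalenceI[OF relation_H(1) _ euclidean_H])
    show "related ?H (Ide C (rel_obj C S)) (Ide C (rel_obj C S))"
      by (rule relatedI[of g "rel_obj C S"]) (simp_all add: relation_H(2) g(1))
  qed
  show "is_reflexivity C X R s" by (rule s)
  show "equ_morphism C T S (snd R) (snd ?H)"
    by (simp add: equ_morphism_def hom_def)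
  show "equ_morphism C S T s g"
    using fibrant by (simp add: fibrant_def)
  show "fibrant C T S (fst R) (fst ?H)"
    using fibrant_p0 by simp
qed

end

context saturated_relation
begin

text \<open>Both legs of \<open>R\<close> are retractions of \<open>s\<close>, so
  \<open>related_S\<close> applies to each of them and supplies \<open>p0\<close> and
  \<open>p1\<close>.\<close>

lemma centralize_inverse_image: "centralize C X R S"
proof -
  have "related S (fst R \<cdot> fst T) (fst R \<cdot> snd T)" "related S (snd R \<cdot> fst T) (snd R \<cdot> snd T)"
    by (rule related_S; simp add: hom_def)+
  then obtain p0 p1 where "p0 \<in> hom C (rel_obj C T) (rel_obj C S)"
      "fst S \<cdot> p0 = fst R \<cdot> fst T" "snd S \<cdot> p0 = fst R \<cdot> snd T"
      "p1 \<in> hom C (rel_obj C T) (rel_obj C S)"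
      "fst S \<cdot> p1 = snd R \<cdot> fst T" "snd S \<cdot> p1 = snd R \<cdot> snd T"
    using relatedE[OF _ relations(3), of _ _ "rel_obj C T"] comp_simps(2) hom_simps by metis
  then interpret double_relation C X R T s r g p0 p1
    by unfold_locales
  show ?thesis by (rule centralize)
qed

end

section \<open>The centralizer as the inverse image of the largest saturated relation\<close>

theorem theorem4p1:
  fixes C :: "('o, 'm) cat" and X :: 'o and R :: "'m \<times> 'm"
  assumes "finitely_complete C"
    and "protomodular C"
    and "equ_saturating C"
    and "X \<in> Obj C"
    and "equivalence C X R"
  shows "\<exists>\<Sigma>. is_largest_equivalence C X (\<lambda>S. centralize C X R S) \<Sigma>"
proof -
  interpret finitely_complete_category C
    by unfold_locales (rule assms(1))
  let ?N = "(pr0 C X X, pr1 C X X)"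
  note R = assms(5)
  obtain s where s: "is_reflexivity C X R s"
    using R by (auto simp: equivalence_def)
  then have s': "s \<in> hom C X (rel_obj C R)" "fst R \<cdot>\<^bsub>C\<^esub> s = Ide C X"
    by (auto simp: is_reflexivity_def)
  note [simp] = homD[OF s'(1)] relation_simps[OF equivalence_relation[OF R]]
  \<comment> \<open>\<open>s\<close> is split by the first leg of \<open>R\<close>.\<close>
  have "monic C s"
  proof (rule monicI[OF s'(1)])
    fix N h k assume h: "h \<in> hom C N X" and k: "k \<in> hom C N X" and eq: "s \<cdot>\<^bsub>C\<^esub> h = s \<cdot>\<^bsub>C\<^esub> k"
    show "h = k"
      using arg_cong[OF eq, of "\<lambda>x. fst R \<cdot>\<^bsub>C\<^esub> x"] comp_reassoc[OF s'(2)] homD[OF h] homD[OF k] by simp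
  qed
  \<comment> \<open>\<open>T\<close> is the saturating relation of \<nabla> along
    \<open>s\<close>.\<close>
  then obtain T where T: "equivalence C (rel_obj C R) T" "saturated C s T"
    and T_max: "\<And>V. equivalence C (rel_obj C R) V \<Longrightarrow> saturated C s V \<Longrightarrow>
      included C (inverse_image C s V) ?N \<Longrightarrow> included C V T"
    using assms(3) indiscrete_equivalence(1)[OF assms(4)]
    unfolding equ_saturating_def is_largest_equivalence_def
    by (metis homD(2,3)[OF s'(1)])
  obtain g where "fibrant C (inverse_image C s T) T s g"
    using T(2) by (auto simp: saturated_def)
  moreover obtain r where "is_reflexivity C (rel_obj C R) T r"
    using T(1) by (auto simp: equivalence_def)
  ultimately interpret saturated_relation C X R T s r g
    using assms(2) R s T(1) by unfold_locales
  \<comment> \<open>Maximality: a centralizing \<open>S'\<close> is carried by \<open>s\<close> into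
    some \<open>V\<close> for which \<open>s\<close> is saturated. Then \<open>V\<close> lies in
    \<open>T\<close>, and pulling back along \<open>s\<close> puts \<open>S'\<close> inside the
    inverse image of \<open>T\<close>.\<close>
  have "included C S' (inverse_image C s T)"
    if S': "equivalence C X S'" and cent: "centralize C X R S'" for S'
  proof -
    obtain V where V: "equivalence C (rel_obj C R) V" "saturated C s V"
      and S'_V: "\<And>x y. related S' x y \<Longrightarrow> related V (s \<cdot>\<^bsub>C\<^esub> x) (s \<cdot>\<^bsub>C\<^esub> y)"
      by (rule centralizeE[OF R S' s cent]) blast
    note rV = equivalence_relation[OF V(1)] and rS' = equivalence_relation[OF S']
    note rI = relation_inverse_image[OF rV s'(1)]
    have "included C (inverse_image C s V) ?N"
    proof (rule includedI[OF rI equivalence_relation[OF indiscrete_equivalence(1)[OF assms(4)]]])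
      show "related ?N (fst (inverse_image C s V)) (snd (inverse_image C s V))"
        by (rule indiscrete_equivalence(2)[OF assms(4), of _ "rel_obj C (inverse_image C s V)"])
          (use relation_simps[OF rI] in \<open>simp_all add: hom_def\<close>)
    qed
    then have "included C V T"
      by (rule T_max[OF V])
    then have "related T (s \<cdot>\<^bsub>C\<^esub> fst S') (s \<cdot>\<^bsub>C\<^esub> snd S')"
      by (rule includedD[OF rV relations(2) _ S'_V[OF related_legs[OF rS']]])
    then have "related (inverse_image C s T) (fst S') (snd S')"
      using related_inverse_image_iff[OF relations(2) s'(1), of "fst S'" "rel_obj C S'" "snd S'"]
        relation_simps[OF rS'] by (simp add: hom_def)
    then show ?thesis
      by (rule includedI[OF rS' relations(3)])
  qed
  then show ?thesis
    using S centralize_inverse_image unfolding is_largest_equivalence_def by blast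
qed

end
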